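(* Let $N$ be a closed $6$-dimensional manifold. The only stationary solutions to the unnormalized $L^2$-gradient flow $$\begin{aligned} \partial_tg&=\tfrac12h^{1/2}\Big(\mathrm{Ric}-\tfrac12\mathrm{Scal}\,g\Big)-\tfrac12\Big(\mathrm{Hess}(h^{1/2})-(\Delta h^{1/2})\,g\Big)-\tfrac18h^{-1}\Big(j(F)-\tfrac12|F|^2g\Big),\\ \partial_th&=-\tfrac14h^{-1/2}\mathrm{Scal}(g)-\tfrac18h^{-2}|F|^2,\\ \partial_t\eta&=\tfrac14\,d^*(h^{-1}F), \end{aligned}$$ with $F=d\eta$ and $j(F)_{ij}=F_{ik}F_j{}^k$, are trivial configurations where: (1) The principal $\mathbb S^1$-bundle is flat, that is, $F\equiv0$. (2) The base manifold is scalar-flat, that is, $\mathrm{Scal}(g)=0$. (3) The fiber-length function is constant, that is, $h=\mathrm{constant}$.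
   Context: $g$ is a Riemannian metric on $N$, $h>0$ a smooth function on $N$, and $\eta$ a connection $1$-form on a principal $\mathbb S^1$-bundle over $N$; $F=d\eta$ is identified with a closed $2$-form on $N$. $\mathrm{Ric}$, $\mathrm{Scal}$, $\mathrm{Hess}$, $\Delta=\operatorname{tr}_g\mathrm{Hess}$, $d^*$ are taken with respect to $g$, and $|F|^2=F_{ij}F^{ij}$, so that $\operatorname{tr}_g(j(F))=|F|^2$. The manifold $N$ is connected. A stationary solution is a triple $(g,h,\eta)$ with $\partial_tg=0$, $\partial_th=0$, $\partial_t\eta=0$, i.e. all three right-hand sides vanish. The flow is the paper's formal negative $L^2$-gradient flow of the functional $\int_N(\frac12h^{1/2}\mathrm{Scal}(g)-\frac18h^{-1}|F|^2)dV_g$. *)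

theory Defs
  imports "HOL-Analysis.Analysis"
begin

section \<open>Smooth maps between open subsets of normed spaces\<close>

fun Ck_on :: "nat \<Rightarrow> 'a::real_normed_vector set \<Rightarrow> ('a \<Rightarrow> 'b::real_normed_vector) \<Rightarrow> bool" where
  "Ck_on 0 S f \<longleftrightarrow> continuous_on S f"
| "Ck_on (Suc k) S f \<longleftrightarrow>
     (\<forall>x\<in>S. f differentiable (at x)) \<and>
     (\<forall>v. Ck_on k S (\<lambda>x. frechet_derivative f (at x) v))"

definition smooth_on :: "'a::real_normed_vector set \<Rightarrow> ('a \<Rightarrow> 'b::real_normed_vector) \<Rightarrow> bool" where
  "smooth_on S f \<longleftrightarrow> (\<forall>k. Ck_on k S f)"


section \<open>Smooth manifolds\<close>

text \<open>
  A chart is a pair of a domain and a coordinate map; only the values of the coordinate map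
  on the domain matter.  The atlas need not be maximal.  The dimension is that of the model
  space \<open>'e\<close>.
\<close>

type_synonym ('a, 'e) chart = "'a set \<times> ('a \<Rightarrow> 'e)"

record ('a, 'e) manifold =
  mtop :: "'a topology"
  atlas :: "('a, 'e) chart set"

abbreviation points :: "('a, 'e) manifold \<Rightarrow> 'a set" where
  "points M \<equiv> topspace (mtop M)"

abbreviation crange :: "('a, 'e) chart \<Rightarrow> 'e set" where
  "crange c \<equiv> snd c ` fst c"

definition is_chart :: "'a topology \<Rightarrow> ('a, 'e::euclidean_space) chart \<Rightarrow> bool" where
  "is_chart X c \<longleftrightarrow> openin X (fst c) \<and> open (crange c) \<and>
     homeomorphic_map (subtopology X (fst c)) (top_of_set (crange c)) (snd c)"

definition local_rep :: "('a, 'e) chart \<Rightarrow> ('b, 'f) chart \<Rightarrow> ('a \<Rightarrow> 'b) \<Rightarrow> 'e \<Rightarrow> 'f" where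
  "local_rep c d f = snd d \<circ> f \<circ> inv_into (fst c) (snd c)"

definition local_fun :: "('a, 'e) chart \<Rightarrow> ('a \<Rightarrow> 'r) \<Rightarrow> 'e \<Rightarrow> 'r" where
  "local_fun c f = f \<circ> inv_into (fst c) (snd c)"

definition second_countable :: "'a topology \<Rightarrow> bool" where
  "second_countable X \<longleftrightarrow> (\<exists>\<B>. countable \<B> \<and> (\<forall>V\<in>\<B>. openin X V) \<and>
     (\<forall>U x. openin X U \<and> x \<in> U \<longrightarrow> (\<exists>V\<in>\<B>. x \<in> V \<and> V \<subseteq> U)))"

definition smooth_manifold :: "('a, 'e::euclidean_space) manifold \<Rightarrow> bool" where
  "smooth_manifold M \<longleftrightarrow>
     Hausdorff_space (mtop M) \<and> second_countable (mtop M) \<and>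
     (\<forall>c\<in>atlas M. is_chart (mtop M) c) \<and>
     (\<Union>c\<in>atlas M. fst c) = points M \<and>
     (\<forall>c\<in>atlas M. \<forall>d\<in>atlas M. smooth_on (snd c ` (fst c \<inter> fst d)) (local_rep c d id))"

text \<open>Charts have open range, so there is no boundary.\<close>

definition closed_connected_manifold :: "('a, 'e::euclidean_space) manifold \<Rightarrow> bool" where
  "closed_connected_manifold M \<longleftrightarrow>
     smooth_manifold M \<and> compact_space (mtop M) \<and> connected_space (mtop M)"

definition smooth_map ::
  "('a, 'e::euclidean_space) manifold \<Rightarrow> ('b, 'f::euclidean_space) manifold \<Rightarrow> ('a \<Rightarrow> 'b) \<Rightarrow> bool" where
  "smooth_map M M' f \<longleftrightarrow> continuous_map (mtop M) (mtop M') f \<and>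
     (\<forall>c\<in>atlas M. \<forall>d\<in>atlas M'. smooth_on (snd c ` (fst c \<inter> f -` fst d)) (local_rep c d f))"

definition smooth_fun :: "('a, 'e::euclidean_space) manifold \<Rightarrow> ('a \<Rightarrow> real) \<Rightarrow> bool" where
  "smooth_fun M f \<longleftrightarrow> (\<forall>c\<in>atlas M. smooth_on (crange c) (local_fun c f))"

definition diffeomorphism ::
  "('a, 'e::euclidean_space) manifold \<Rightarrow> ('b, 'f::euclidean_space) manifold \<Rightarrow> ('a \<Rightarrow> 'b) \<Rightarrow> bool" where
  "diffeomorphism M M' f \<longleftrightarrow> smooth_map M M' f \<and>
     (\<exists>f'. smooth_map M' M f' \<and> (\<forall>p\<in>points M. f' (f p) = p) \<and> (\<forall>q\<in>points M'. f (f' q) = q))"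

definition open_submanifold :: "('a, 'e) manifold \<Rightarrow> 'a set \<Rightarrow> ('a, 'e) manifold" where
  "open_submanifold M U =
     \<lparr>mtop = subtopology (mtop M) U, atlas = (\<lambda>c. (fst c \<inter> U, snd c)) ` atlas M\<rparr>"

definition product_manifold ::
  "('a, 'e) manifold \<Rightarrow> ('b, 'f) manifold \<Rightarrow> ('a \<times> 'b, 'e \<times> 'f) manifold" where
  "product_manifold M M' =
     \<lparr>mtop = prod_topology (mtop M) (mtop M'),
      atlas = {(fst c \<times> fst d, map_prod (snd c) (snd d)) | c d. c \<in> atlas M \<and> d \<in> atlas M'}\<rparr>"

text \<open>The unit circle in the complex plane, with the local inverses of \<open>cis\<close> as charts.\<close>

definition circle :: "(complex, real) manifold" where
  "circle = \<lparr>mtop = top_of_set (sphere 0 1),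
     atlas = range (\<lambda>a::real. (cis ` {a<..<a + 2 * pi}, inv_into {a<..<a + 2 * pi} cis))\<rparr>"


section \<open>Covariant tensor fields\<close>

text \<open>
  A covariant tensor field is given by its coordinate expressions: for every chart \<open>c\<close>, a
  multilinear form on the model space at every point of \<open>crange c\<close>.  That these expressions
  fit together is expressed as invariance under pullback by the identity map, which is the
  usual transformation law.
\<close>

type_synonym ('a, 'e) field1 = "('a, 'e) chart \<Rightarrow> 'e \<Rightarrow> 'e \<Rightarrow> real"
type_synonym ('a, 'e) field2 = "('a, 'e) chart \<Rightarrow> 'e \<Rightarrow> 'e \<Rightarrow> 'e \<Rightarrow> real"

text \<open>\<open>is_pullback1 M M' f \<omega> \<omega>'\<close> says that \<open>\<omega>'\<close> is the pullback along \<open>f : M \<rightarrow> M'\<close> of \<open>\<omega>\<close>.\<close>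

definition is_pullback1 ::
  "('a, 'e::euclidean_space) manifold \<Rightarrow> ('b, 'f::euclidean_space) manifold \<Rightarrow> ('a \<Rightarrow> 'b) \<Rightarrow>
   ('b, 'f) field1 \<Rightarrow> ('a, 'e) field1 \<Rightarrow> bool" where
  "is_pullback1 M M' f \<omega> \<omega>' \<longleftrightarrow>
     (\<forall>c\<in>atlas M. \<forall>d\<in>atlas M'. \<forall>p\<in>fst c. f p \<in> fst d \<longrightarrow>
       (let D = frechet_derivative (local_rep c d f) (at (snd c p)) in
        \<forall>v. \<omega>' c (snd c p) v = \<omega> d (snd d (f p)) (D v)))"

definition is_pullback2 ::
  "('a, 'e::euclidean_space) manifold \<Rightarrow> ('b, 'f::euclidean_space) manifold \<Rightarrow> ('a \<Rightarrow> 'b) \<Rightarrow>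
   ('b, 'f) field2 \<Rightarrow> ('a, 'e) field2 \<Rightarrow> bool" where
  "is_pullback2 M M' f \<omega> \<omega>' \<longleftrightarrow>
     (\<forall>c\<in>atlas M. \<forall>d\<in>atlas M'. \<forall>p\<in>fst c. f p \<in> fst d \<longrightarrow>
       (let D = frechet_derivative (local_rep c d f) (at (snd c p)) in
        \<forall>v w. \<omega>' c (snd c p) v w = \<omega> d (snd d (f p)) (D v) (D w)))"

definition one_form :: "('a, 'e::euclidean_space) manifold \<Rightarrow> ('a, 'e) field1 \<Rightarrow> bool" where
  "one_form M \<omega> \<longleftrightarrow> is_pullback1 M M id \<omega> \<omega> \<and>
     (\<forall>c\<in>atlas M. (\<forall>x\<in>crange c. linear (\<omega> c x)) \<and> (\<forall>v. smooth_on (crange c) (\<lambda>x. \<omega> c x v)))"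

definition two_tensor :: "('a, 'e::euclidean_space) manifold \<Rightarrow> ('a, 'e) field2 \<Rightarrow> bool" where
  "two_tensor M T \<longleftrightarrow> is_pullback2 M M id T T \<and>
     (\<forall>c\<in>atlas M. (\<forall>x\<in>crange c. bilinear (T c x)) \<and> (\<forall>v w. smooth_on (crange c) (\<lambda>x. T c x v w)))"

definition two_form :: "('a, 'e::euclidean_space) manifold \<Rightarrow> ('a, 'e) field2 \<Rightarrow> bool" where
  "two_form M F \<longleftrightarrow> two_tensor M F \<and>
     (\<forall>c\<in>atlas M. \<forall>x\<in>crange c. \<forall>v w. F c x v w = - F c x w v)"

definition riemannian_metric :: "('a, 'e::euclidean_space) manifold \<Rightarrow> ('a, 'e) field2 \<Rightarrow> bool" where
  "riemannian_metric M g \<longleftrightarrow> two_tensor M g \<and>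
     (\<forall>c\<in>atlas M. \<forall>x\<in>crange c.
       (\<forall>v w. g c x v w = g c x w v) \<and> (\<forall>v. v \<noteq> 0 \<longrightarrow> g c x v v > 0))"

text \<open>Normalised so that \<open>(d\<omega>)\<^sub>i\<^sub>j = \<partial>\<^sub>i \<omega>\<^sub>j - \<partial>\<^sub>j \<omega>\<^sub>i\<close>.\<close>

definition ext_deriv1 :: "('a, 'e::euclidean_space) field1 \<Rightarrow> ('a, 'e) field2" where
  "ext_deriv1 \<omega> c x v w =
     frechet_derivative (\<lambda>y. \<omega> c y w) (at x) v - frechet_derivative (\<lambda>y. \<omega> c y v) (at x) w"


section \<open>Principal circle bundles and connections\<close>

definition principal_circle_bundle ::
  "('b, 'f::euclidean_space) manifold \<Rightarrow> ('a, 'e::euclidean_space) manifold \<Rightarrow> ('b \<Rightarrow> 'a) \<Rightarrow>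
   (complex \<Rightarrow> 'b \<Rightarrow> 'b) \<Rightarrow> bool" where
  "principal_circle_bundle P N \<pi> act \<longleftrightarrow>
     smooth_manifold P \<and> smooth_manifold N \<and> smooth_map P N \<pi> \<and>
     smooth_map (product_manifold circle P) P (\<lambda>(z, p). act z p) \<and>
     (\<forall>p\<in>points P. act 1 p = p) \<and>
     (\<forall>z\<in>points circle. \<forall>w\<in>points circle. \<forall>p\<in>points P. act (z * w) p = act z (act w p)) \<and>
     (\<forall>z\<in>points circle. \<forall>p\<in>points P. \<pi> (act z p) = \<pi> p) \<and>
     (\<forall>x\<in>points N. \<exists>U \<Phi>. openin (mtop N) U \<and> x \<in> U \<and>
        diffeomorphism (open_submanifold P {p \<in> points P. \<pi> p \<in> U})
          (product_manifold (open_submanifold N U) circle) \<Phi> \<and>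
        (\<forall>p\<in>points P. \<pi> p \<in> U \<longrightarrow> fst (\<Phi> p) = \<pi> p \<and>
           (\<forall>z\<in>points circle. snd (\<Phi> (act z p)) = z * snd (\<Phi> p))))"

text \<open>
  Connection forms are real valued: the Lie algebra of the circle is identified with the reals
  through the generator \<open>t \<mapsto> cis t\<close>.
\<close>

definition connection_form ::
  "('b, 'f::euclidean_space) manifold \<Rightarrow> (complex \<Rightarrow> 'b \<Rightarrow> 'b) \<Rightarrow> ('b, 'f) field1 \<Rightarrow> bool" where
  "connection_form P act \<eta> \<longleftrightarrow> one_form P \<eta> \<and>
     (\<forall>z\<in>points circle. is_pullback1 P P (act z) \<eta> \<eta>) \<and>
     (\<forall>d\<in>atlas P. \<forall>p\<in>fst d.
        \<eta> d (snd d p) (vector_derivative (\<lambda>t. snd d (act (cis t) p)) (at 0)) = 1)"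

text \<open>\<open>F\<close> is the form on the base to which \<open>d\<eta>\<close> descends.\<close>

definition curvature_form ::
  "('b, 'f::euclidean_space) manifold \<Rightarrow> ('a, 'e::euclidean_space) manifold \<Rightarrow> ('b \<Rightarrow> 'a) \<Rightarrow>
   ('b, 'f) field1 \<Rightarrow> ('a, 'e) field2 \<Rightarrow> bool" where
  "curvature_form P N \<pi> \<eta> F \<longleftrightarrow> two_form N F \<and> is_pullback2 P N \<pi> F (ext_deriv1 \<eta>)"


section \<open>Riemannian geometry in coordinates\<close>

text \<open>In this section \<open>G i j\<close> and \<open>F i j\<close> are components of a metric and of a 2-form in a chart.\<close>

type_synonym 'n comps = "'n \<Rightarrow> 'n \<Rightarrow> real^'n \<Rightarrow> real"

definition coord_comps :: "('a, real^'n::finite) field2 \<Rightarrow> ('a, real^'n) chart \<Rightarrow> 'n comps" where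
  "coord_comps T c i j x = T c x (axis i 1) (axis j 1)"

definition pd :: "'n::finite \<Rightarrow> (real^'n \<Rightarrow> real) \<Rightarrow> real^'n \<Rightarrow> real" where
  "pd i f x = frechet_derivative f (at x) (axis i 1)"

definition ginv :: "'n::finite comps \<Rightarrow> 'n comps" where
  "ginv G i j x = matrix_inv (\<chi> k l. G k l x) $ i $ j"

text \<open>\<open>christoffel G k i j\<close> is \<open>\<Gamma>\<^sup>k\<^sub>i\<^sub>j\<close>.\<close>

definition christoffel :: "'n::finite comps \<Rightarrow> 'n \<Rightarrow> 'n \<Rightarrow> 'n \<Rightarrow> real^'n \<Rightarrow> real" where
  "christoffel G k i j x =
     (1/2) * (\<Sum>l\<in>UNIV. ginv G k l x * (pd i (G j l) x + pd j (G i l) x - pd l (G i j) x))"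

text \<open>\<open>riemann G l i j k\<close> is the \<open>l\<close>-th component of \<open>R(\<partial>\<^sub>i, \<partial>\<^sub>j) \<partial>\<^sub>k\<close>; round spheres have positive
  Ricci curvature.\<close>

definition riemann :: "'n::finite comps \<Rightarrow> 'n \<Rightarrow> 'n \<Rightarrow> 'n \<Rightarrow> 'n \<Rightarrow> real^'n \<Rightarrow> real" where
  "riemann G l i j k x =
     pd i (christoffel G l j k) x - pd j (christoffel G l i k) x
     + (\<Sum>m\<in>UNIV. christoffel G l i m x * christoffel G m j k x
                   - christoffel G l j m x * christoffel G m i k x)"

definition ricci :: "'n::finite comps \<Rightarrow> 'n comps" where
  "ricci G j k x = (\<Sum>i\<in>UNIV. riemann G i i j k x)"

definition trace_g :: "'n::finite comps \<Rightarrow> 'n comps \<Rightarrow> real^'n \<Rightarrow> real" where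
  "trace_g G T x = (\<Sum>i\<in>UNIV. \<Sum>j\<in>UNIV. ginv G i j x * T i j x)"

definition scal :: "'n::finite comps \<Rightarrow> real^'n \<Rightarrow> real" where
  "scal G = trace_g G (ricci G)"

definition hess :: "'n::finite comps \<Rightarrow> (real^'n \<Rightarrow> real) \<Rightarrow> 'n comps" where
  "hess G u i j x = pd i (pd j u) x - (\<Sum>k\<in>UNIV. christoffel G k i j x * pd k u x)"

definition laplacian :: "'n::finite comps \<Rightarrow> (real^'n \<Rightarrow> real) \<Rightarrow> real^'n \<Rightarrow> real" where
  "laplacian G u = trace_g G (hess G u)"

definition jF :: "'n::finite comps \<Rightarrow> 'n comps \<Rightarrow> 'n comps" where
  "jF G F i j x = (\<Sum>k\<in>UNIV. \<Sum>l\<in>UNIV. ginv G k l x * F i k x * F j l x)"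

definition norm2F :: "'n::finite comps \<Rightarrow> 'n comps \<Rightarrow> real^'n \<Rightarrow> real" where
  "norm2F G F x = (\<Sum>i\<in>UNIV. \<Sum>j\<in>UNIV. \<Sum>k\<in>UNIV. \<Sum>l\<in>UNIV.
     ginv G i k x * ginv G j l x * F i j x * F k l x)"

text \<open>\<open>cov_deriv2 G B k i j\<close> is \<open>\<nabla>\<^sub>k B\<^sub>i\<^sub>j\<close>.\<close>

definition cov_deriv2 :: "'n::finite comps \<Rightarrow> 'n comps \<Rightarrow> 'n \<Rightarrow> 'n comps" where
  "cov_deriv2 G B k i j x = pd k (B i j) x
     - (\<Sum>m\<in>UNIV. christoffel G m k i x * B m j x + christoffel G m k j x * B i m x)"

text \<open>The codifferential of a 2-form, \<open>(d\<^sup>* B)\<^sub>j = - \<nabla>\<^sup>i B\<^sub>i\<^sub>j\<close>.\<close>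

definition codiff2 :: "'n::finite comps \<Rightarrow> 'n comps \<Rightarrow> 'n \<Rightarrow> real^'n \<Rightarrow> real" where
  "codiff2 G B j x = - (\<Sum>i\<in>UNIV. \<Sum>k\<in>UNIV. ginv G i k x * cov_deriv2 G B k i j x)"


section \<open>The flow and its stationary solutions\<close>

definition flow_g :: "'n::finite comps \<Rightarrow> (real^'n \<Rightarrow> real) \<Rightarrow> 'n comps \<Rightarrow> 'n comps" where
  "flow_g G h F i j x =
     (1/2) * h x powr (1/2) * (ricci G i j x - (1/2) * scal G x * G i j x)
     - (1/2) * (hess G (\<lambda>y. h y powr (1/2)) i j x - laplacian G (\<lambda>y. h y powr (1/2)) x * G i j x)
     - (1/8) * h x powr (-1) * (jF G F i j x - (1/2) * norm2F G F x * G i j x)"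

definition flow_h :: "'n::finite comps \<Rightarrow> (real^'n \<Rightarrow> real) \<Rightarrow> 'n comps \<Rightarrow> real^'n \<Rightarrow> real" where
  "flow_h G h F x =
     - (1/4) * h x powr (-1/2) * scal G x - (1/8) * h x powr (-2) * norm2F G F x"

definition flow_eta :: "'n::finite comps \<Rightarrow> (real^'n \<Rightarrow> real) \<Rightarrow> 'n comps \<Rightarrow> 'n \<Rightarrow> real^'n \<Rightarrow> real" where
  "flow_eta G h F j x = (1/4) * codiff2 G (\<lambda>i k y. h y powr (-1) * F i k y) j x"

text \<open>
  The variation of a connection form is the pullback of a 1-form on the base, so \<open>\<partial>\<^sub>t \<eta> = 0\<close>
  is the vanishing of a 1-form on the base.
\<close>

definition stationary ::
  "('a, real^'n::finite) manifold \<Rightarrow> ('a, real^'n) field2 \<Rightarrow> ('a \<Rightarrow> real) \<Rightarrow> ('a, real^'n) field2 \<Rightarrow> bool" where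
  "stationary N g h F \<longleftrightarrow>
     (\<forall>c\<in>atlas N. \<forall>x\<in>crange c.
        (let G = coord_comps g c; hc = local_fun c h; Fc = coord_comps F c in
          (\<forall>i j. flow_g G hc Fc i j x = 0) \<and>
          flow_h G hc Fc x = 0 \<and>
          (\<forall>j. flow_eta G hc Fc j x = 0)))"

end

theory Submission
  imports Defs
begin

text \<open>
  Taking the \<open>g\<close>-trace of the first equation in dimension 6 and eliminating the scalar curvature
  with the second one leaves \<open>\<Delta>u = - (3/10) u\<^sup>-\<^sup>2 |F|\<^sup>2 \<le> 0\<close> for \<open>u = h\<^sup>1\<^sup>/\<^sup>2\<close>.  A superharmonic function
  on a closed connected manifold is constant by Hopf's strong minimum principle, so \<open>|F|\<^sup>2 = 0\<close>, and
  then the second equation gives vanishing scalar curvature.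
\<close>

section \<open>Positive definite matrices\<close>

text \<open>Integrating \<Delta>u over the closed manifold would also force it to vanish, but that
  route needs volume forms and a divergence theorem. The minimum principle is local: it runs inside
  one chart and asks of the coefficients only continuity and positive definiteness. The global
  structure enters through compactness (a minimum is attained) and connectedness (the minimum set is
  open and closed). In dimension n the elimination gives the factor -(3/8)(n-2)/(n-1), which is
  -3/10 for n = 6; the argument lives on its being negative, both for superharmonicity and for
  recovering |F|^2 = 0 from \<Delta>u = 0. Writing a positive definite matrix as E^T E serves twice:
  it makes the trace against a nonnegative Hessian nonnegative, and it exhibits |F|^2 as a sum of
  squares, although F is contracted with two copies of the inverse metric.\<close>

lemma pos_def_sum_of_squares:
  fixes a :: "'n \<Rightarrow> 'n \<Rightarrow> real"
  assumes "finite S"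
    and "\<And>i j. i \<in> S \<Longrightarrow> j \<in> S \<Longrightarrow> a i j = a j i"
    and "\<And>x. \<exists>i\<in>S. x i \<noteq> 0 \<Longrightarrow> (\<Sum>i\<in>S. \<Sum>j\<in>S. a i j * x i * x j) > 0"
  shows "\<exists>e. \<forall>i\<in>S. \<forall>j\<in>S. a i j = (\<Sum>m\<in>S. e m i * e m j)"
  using assms
\<comment> \<open>This is Cholesky decomposition by completing squares. Arrays over a finite set,
  instead of matrices, allow one index to be split off at a time.\<close>
proof (induction S arbitrary: a rule: finite_induct)
  case empty
  then show ?case by simp
next
  case (insert k T)
  note sym = insert.prems(1) and pos = insert.prems(2)
  have split_form: "(\<Sum>i\<in>insert k T. \<Sum>j\<in>insert k T. a i j * x i * x j)
      = a k k * x k * x k + 2 * x k * (\<Sum>i\<in>T. a k i * x i) + (\<Sum>i\<in>T. \<Sum>j\<in>T. a i j * x i * x j)" for x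
  proof -
    have "(\<Sum>i\<in>T. a i k * x i * x k) = x k * (\<Sum>i\<in>T. a k i * x i)"
      unfolding sum_distrib_left by (intro sum.cong) (auto simp: sym)
    moreover have "(\<Sum>j\<in>T. a k j * x k * x j) = x k * (\<Sum>i\<in>T. a k i * x i)"
      unfolding sum_distrib_left by (intro sum.cong) (auto simp: sym)
    ultimately show ?thesis
      using insert.hyps by (simp add: sum.distrib algebra_simps)
  qed
  have akk: "a k k > 0"
  proof -
    have "(\<Sum>i\<in>T. a k i * (if i = k then 1 else 0)) = 0"
      "(\<Sum>i\<in>T. \<Sum>j\<in>T. a i j * (if i = k then 1 else 0) * (if j = k then 1 else 0)) = 0"
      using insert.hyps by (auto intro!: sum.neutral)
    then show ?thesis
      using pos[of "\<lambda>i. if i = k then 1 else 0"] split_form[of "\<lambda>i. if i = k then 1 else 0"] by simp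
  qed
  \<comment> \<open>The Schur complement of the pivot \<open>a k k\<close>: what remains of the form
    after completing the square in the variable \<open>x k\<close>.\<close>
  define b where "b i j = a i j - a k i * a k j / a k k" for i j
  have "\<exists>e. \<forall>i\<in>T. \<forall>j\<in>T. b i j = (\<Sum>m\<in>T. e m i * e m j)"
  proof (rule insert.IH)
    show "b i j = b j i" if "i \<in> T" "j \<in> T" for i j
      using that sym by (simp add: b_def)
    show "(\<Sum>i\<in>T. \<Sum>j\<in>T. b i j * x i * x j) > 0" if "\<exists>i\<in>T. x i \<noteq> 0" for x
    proof -
      define s where "s = (\<Sum>i\<in>T. a k i * x i)"
      \<comment> \<open>This value at \<open>k\<close> minimises the form in that variable, so the
        \<open>a\<close>-form at \<open>y\<close> equals the \<open>b\<close>-form at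
        \<open>x\<close>.\<close>
      define y where "y = x(k := - s / a k k)"
      have yT: "y i = x i" if "i \<in> T" for i
        using that insert.hyps by (auto simp: y_def)
      have "(\<Sum>i\<in>insert k T. \<Sum>j\<in>insert k T. a i j * y i * y j) > 0"
        using that yT by (intro pos) auto
      moreover have "(\<Sum>i\<in>insert k T. \<Sum>j\<in>insert k T. a i j * y i * y j)
          = a k k * (- s / a k k) * (- s / a k k) + 2 * (- s / a k k) * s + (\<Sum>i\<in>T. \<Sum>j\<in>T. a i j * x i * x j)"
        unfolding split_form using yT by (simp add: s_def y_def)
      moreover have "(\<Sum>i\<in>T. \<Sum>j\<in>T. (a k i * a k j / a k k) * x i * x j) = s * s / a k k"
        unfolding s_def sum_product sum_divide_distrib by (intro sum.cong refl) simp
      moreover have "(\<Sum>i\<in>T. \<Sum>j\<in>T. b i j * x i * x j)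
          = (\<Sum>i\<in>T. \<Sum>j\<in>T. a i j * x i * x j) - (\<Sum>i\<in>T. \<Sum>j\<in>T. (a k i * a k j / a k k) * x i * x j)"
        by (simp add: b_def left_diff_distrib sum_subtractf)
      ultimately show ?thesis
        using akk by simp
    qed
  qed
  then obtain e where e: "\<And>i j. i \<in> T \<Longrightarrow> j \<in> T \<Longrightarrow> b i j = (\<Sum>m\<in>T. e m i * e m j)"
    by blast
  define e' where "e' m i = (if m = k then a k i / sqrt (a k k) else if i = k then 0 else e m i)" for m i
  have sq: "a k i / sqrt (a k k) * (a k j / sqrt (a k k)) = a k i * a k j / a k k" for i j
    using akk by simp
  have "a i j = (\<Sum>m\<in>insert k T. e' m i * e' m j)" if "i \<in> insert k T" "j \<in> insert k T" for i j
  proof -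
    have "(\<Sum>m\<in>T. e' m i * e' m j) = (\<Sum>m\<in>T. if i = k \<or> j = k then 0 else e m i * e m j)"
      using insert.hyps by (intro sum.cong) (auto simp: e'_def)
    also have "\<dots> = a i j - a k i * a k j / a k k"
    proof (cases "i = k \<or> j = k")
      case True
      then show ?thesis using akk sym[OF that] by auto
    next
      case False
      then have "i \<in> T" "j \<in> T" using that by auto
      from e[OF this] show ?thesis using False by (simp add: b_def)
    qed
    finally show ?thesis
      using insert.hyps sq by (simp add: e'_def)
  qed
  then show ?case by blast
qed

definition pos_def :: "real^'n^'n \<Rightarrow> bool" where
  "pos_def A \<longleftrightarrow> transpose A = A \<and> (\<forall>x. x \<noteq> 0 \<longrightarrow> x \<bullet> (A *v x) > 0)"

lemma pos_def_invertible:
  fixes A :: "real^'n^'n"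
  assumes "pos_def A"
  shows "invertible A"
proof -
  have "x = 0" if "A *v x = 0" for x
  proof (rule ccontr)
    assume "x \<noteq> 0"
    then have "x \<bullet> (A *v x) > 0"
      using assms by (simp add: pos_def_def)
    then show False
      using that by simp
  qed
  then have "inj ((*v) A)"
    by (simp add: linear_injective_0)
  then show ?thesis
    using invertible_left_inverse matrix_left_invertible_injective by blast
qed

lemma matrix_inv_mult:
  fixes A :: "real^'n^'n"
  assumes "invertible A"
  shows "A ** matrix_inv A = mat 1" "matrix_inv A ** A = mat 1"
  using someI_ex[OF assms[unfolded invertible_def]] by (simp_all add: matrix_inv_def)

lemma pos_def_matrix_inv:
  fixes A :: "real^'n^'n"
  assumes "pos_def A"
  shows "pos_def (matrix_inv A)"
proof -
  note inv = matrix_inv_mult[OF pos_def_invertible[OF assms]]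
  have sym: "transpose A = A"
    using assms by (simp add: pos_def_def)
  have "transpose (matrix_inv A) = transpose (matrix_inv A) ** (A ** matrix_inv A)"
    using inv by simp
  also have "\<dots> = transpose (A ** matrix_inv A) ** matrix_inv A"
    by (simp add: matrix_transpose_mul matrix_mul_assoc sym)
  also have "\<dots> = matrix_inv A"
    using inv by simp
  finally have *: "transpose (matrix_inv A) = matrix_inv A" .
  have "x \<bullet> (matrix_inv A *v x) > 0" if "x \<noteq> 0" for x
  proof -
    have x: "A *v (matrix_inv A *v x) = x"
      using inv by (simp add: matrix_vector_mul_assoc)
    then have "matrix_inv A *v x \<noteq> 0"
      using that by (metis matrix_vector_mult_0_right)
    then have "(matrix_inv A *v x) \<bullet> (A *v (matrix_inv A *v x)) > 0"
      using assms by (simp add: pos_def_def)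
    then show ?thesis
      using x by (simp add: inner_commute)
  qed
  then show ?thesis
    using * by (simp add: pos_def_def)
qed

lemma pos_def_factorization:
  fixes A :: "real^'n^'n"
  assumes "pos_def A"
  obtains E :: "real^'n^'n" where "A = transpose E ** E" "invertible E"
proof -
  have "transpose A = A"
    using assms by (simp add: pos_def_def)
  then have sym: "A$i$j = A$j$i" for i j
    by (metis transpose_def vec_lambda_beta)
  have "\<exists>e :: 'n \<Rightarrow> 'n \<Rightarrow> real. \<forall>i\<in>UNIV. \<forall>j\<in>UNIV. A$i$j = (\<Sum>m\<in>UNIV. e m i * e m j)"
  proof (rule pos_def_sum_of_squares[where a = "\<lambda>i j. A$i$j"])
    show "(\<Sum>i\<in>UNIV. \<Sum>j\<in>UNIV. A$i$j * x i * x j) > 0" if "\<exists>i\<in>UNIV. x i \<noteq> 0" for x :: "'n \<Rightarrow> real"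
    proof -
      have "(\<chi> i. x i) \<noteq> 0"
        using that by (auto simp: vec_eq_iff)
      then have "(\<chi> i. x i) \<bullet> (A *v (\<chi> i. x i)) > 0"
        using assms by (simp add: pos_def_def)
      then show ?thesis
        by (simp add: inner_vec_def matrix_vector_mult_def sum_distrib_left mult_ac)
    qed
  qed (auto simp: sym)
  then obtain e :: "'n \<Rightarrow> 'n \<Rightarrow> real" where e: "\<And>i j. A$i$j = (\<Sum>m\<in>UNIV. e m i * e m j)"
    by blast
  define E :: "real^'n^'n" where "E = (\<chi> m i. e m i)"
  have AE: "A = transpose E ** E"
    by (simp add: vec_eq_iff e E_def matrix_matrix_mult_def transpose_def)
  have "det A \<noteq> 0"
    using pos_def_invertible[OF assms] by (simp add: invertible_det_nz)
  then have "invertible E"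
    by (simp add: AE det_mul invertible_det_nz)
  then show ?thesis
    using that AE by blast
qed

text \<open>With A = E^T E the trace is the sum of the values of H on the rows of E. Only the
  quadratic form of H enters, so a Hessian can be inserted without symmetry of mixed partial
  derivatives.\<close>

lemma pos_def_trace_nonneg:
  fixes A H :: "real^'n^'n"
  assumes "pos_def A" "\<And>e. e \<bullet> (H *v e) \<ge> 0"
  shows "(\<Sum>i\<in>UNIV. \<Sum>j\<in>UNIV. A$i$j * H$j$i) \<ge> 0"
proof -
  obtain E :: "real^'n^'n" where E: "A = transpose E ** E"
    using pos_def_factorization[OF assms(1)] by metis
  have "(\<Sum>i\<in>UNIV. \<Sum>j\<in>UNIV. A$i$j * H$j$i)
      = (\<Sum>i\<in>UNIV. \<Sum>j\<in>UNIV. \<Sum>m\<in>UNIV. E$m$j * (H$j$i * E$m$i))"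
    by (simp add: E matrix_matrix_mult_def transpose_def sum_distrib_left sum_distrib_right mult_ac)
  also have "\<dots> = (\<Sum>i\<in>UNIV. \<Sum>m\<in>UNIV. \<Sum>j\<in>UNIV. E$m$j * (H$j$i * E$m$i))"
    by (intro sum.cong refl sum.swap)
  also have "\<dots> = (\<Sum>m\<in>UNIV. \<Sum>i\<in>UNIV. \<Sum>j\<in>UNIV. E$m$j * (H$j$i * E$m$i))"
    by (rule sum.swap)
  also have "\<dots> = (\<Sum>m\<in>UNIV. \<Sum>j\<in>UNIV. \<Sum>i\<in>UNIV. E$m$j * (H$j$i * E$m$i))"
    by (intro sum.cong refl sum.swap)
  also have "\<dots> = (\<Sum>m\<in>UNIV. E$m \<bullet> (H *v E$m))"
    by (simp add: inner_vec_def matrix_vector_mult_def sum_distrib_left)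
  also have "\<dots> \<ge> 0"
    using assms(2) by (simp add: sum_nonneg)
  finally show ?thesis .
qed

text \<open>If A is an inverse metric, the rows of E form an orthonormal frame and E B E^T lists the
  components of B in it. The computation rewrites both sides as the trace of B A B^T A, using that a
  trace is cyclic.\<close>

lemma double_contraction_sum_squares:
  fixes A E B :: "real^'n^'n"
  assumes "A = transpose E ** E"
  shows "(\<Sum>i\<in>UNIV. \<Sum>j\<in>UNIV. \<Sum>k\<in>UNIV. \<Sum>l\<in>UNIV. A$i$k * A$j$l * B$i$j * B$k$l)
    = (\<Sum>m\<in>UNIV. \<Sum>n\<in>UNIV. ((E ** B ** transpose E)$m$n)\<^sup>2)"
proof -
  have sym: "transpose A = A"
    by (simp add: assms matrix_transpose_mul)
  have A_sym: "A$i$j = A$j$i" for i j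
    using sym by (metis transpose_def vec_lambda_beta)
  have norm2: "(\<Sum>m\<in>UNIV. \<Sum>n\<in>UNIV. (C$m$n)\<^sup>2) = trace (C ** transpose C)" for C :: "real^'n^'n"
    by (simp add: trace_def matrix_matrix_mult_def transpose_def power2_eq_square)
  have "(E ** B ** transpose E) ** transpose (E ** B ** transpose E)
      = E ** (B ** A ** transpose B ** transpose E)"
    by (simp add: assms matrix_transpose_mul matrix_mul_assoc)
  then have "(\<Sum>m\<in>UNIV. \<Sum>n\<in>UNIV. ((E ** B ** transpose E)$m$n)\<^sup>2)
      = trace (E ** (B ** A ** transpose B ** transpose E))"
    using norm2 by simp
  also have "\<dots> = trace ((B ** A ** transpose B) ** A)"
    unfolding assms by (subst trace_mul_sym) (simp add: matrix_mul_assoc)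
  also have "\<dots> = (\<Sum>i\<in>UNIV. \<Sum>k\<in>UNIV. \<Sum>l\<in>UNIV. \<Sum>j\<in>UNIV. A$i$k * A$j$l * B$i$j * B$k$l)"
    by (simp add: trace_def matrix_matrix_mult_def transpose_def sum_distrib_left sum_distrib_right A_sym mult_ac)
  also have "\<dots> = (\<Sum>i\<in>UNIV. \<Sum>k\<in>UNIV. \<Sum>j\<in>UNIV. \<Sum>l\<in>UNIV. A$i$k * A$j$l * B$i$j * B$k$l)"
    by (intro sum.cong refl sum.swap)
  also have "\<dots> = (\<Sum>i\<in>UNIV. \<Sum>j\<in>UNIV. \<Sum>k\<in>UNIV. \<Sum>l\<in>UNIV. A$i$k * A$j$l * B$i$j * B$k$l)"
    by (intro sum.cong refl sum.swap)
  finally show ?thesis by simp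
qed

lemma pos_def_double_contraction:
  fixes A B :: "real^'n^'n"
  assumes "pos_def A"
  defines "q \<equiv> (\<Sum>i\<in>UNIV. \<Sum>j\<in>UNIV. \<Sum>k\<in>UNIV. \<Sum>l\<in>UNIV. A$i$k * A$j$l * B$i$j * B$k$l)"
  shows "q \<ge> 0" "q = 0 \<Longrightarrow> B = 0"
proof -
  obtain E :: "real^'n^'n" where E: "A = transpose E ** E" "invertible E"
    using pos_def_factorization[OF assms(1)] by metis
  define C where "C = E ** B ** transpose E"
  have q: "q = (\<Sum>m\<in>UNIV. \<Sum>n\<in>UNIV. (C$m$n)\<^sup>2)"
    unfolding q_def C_def by (rule double_contraction_sum_squares[OF E(1)])
  then show "q \<ge> 0"
    by (simp add: sum_nonneg)
  show "B = 0" if "q = 0"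
  proof -
    have "C = 0"
      using that unfolding q by (simp add: sum_nonneg_eq_0_iff sum_nonneg vec_eq_iff)
    obtain E' where E': "E' ** E = mat 1"
      using E(2) by (auto simp: invertible_def)
    have "transpose E ** transpose E' = mat 1"
      by (metis E' matrix_transpose_mul transpose_mat)
    then have "B = E' ** C ** transpose E'"
      unfolding C_def using E' by (metis matrix_mul_assoc matrix_mul_lid matrix_mul_rid)
    then show ?thesis
      by (simp add: \<open>C = 0\<close> vec_eq_iff matrix_matrix_mult_def)
  qed
qed

section \<open>Continuity of matrix inversion\<close>

lemma matrix_inv_component:
  fixes A :: "real^'n^'n"
  assumes "invertible A"
  shows "matrix_inv A $ i $ j = det (\<chi> r c. if c = i then axis j 1 $ r else A$r$c) / det A"
proof -
  have "A *v column j (matrix_inv A) = axis j 1"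
    unfolding matrix_vector_mult_basis[symmetric]
    by (simp add: matrix_vector_mul_assoc matrix_inv_mult[OF assms])
  then have "column j (matrix_inv A) = (\<chi> k. det (\<chi> r c. if c = k then axis j 1 $ r else A$r$c) / det A)"
    using cramer[of A "column j (matrix_inv A)" "axis j 1"] assms by (simp add: invertible_det_nz)
  then show ?thesis
    by (simp add: column_def vec_eq_iff)
qed

lemma continuous_on_det:
  fixes M :: "'a::topological_space \<Rightarrow> real^'n^'n"
  assumes "\<And>i j. continuous_on S (\<lambda>x. M x $ i $ j)"
  shows "continuous_on S (\<lambda>x. det (M x))"
  unfolding det_def by (intro continuous_intros assms)

text \<open>By Cramer's rule the entries of the inverse are quotients of determinants. This feeds
  the continuity of \<open>ginv\<close> and of the Christoffel symbols, the coefficients of the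
  Laplacian.\<close>

lemma continuous_on_matrix_inv_component:
  fixes M :: "'a::topological_space \<Rightarrow> real^'n^'n"
  assumes "\<And>i j. continuous_on S (\<lambda>x. M x $ i $ j)" "\<And>x. x \<in> S \<Longrightarrow> invertible (M x)"
  shows "continuous_on S (\<lambda>x. matrix_inv (M x) $ i $ j)"
proof -
  have "continuous_on S (\<lambda>x. if c = i then axis j 1 $ r else M x $ r $ c)" for r c
    using assms(1) by (cases "c = i") auto
  then have "continuous_on S (\<lambda>x. det (\<chi> r c. if c = i then axis j 1 $ r else M x $ r $ c))"
    by (intro continuous_on_det) simp
  then have "continuous_on S (\<lambda>x. det (\<chi> r c. if c = i then axis j 1 $ r else M x $ r $ c) / det (M x))"
    using continuous_on_det[OF assms(1)] assms(2)
    by (intro continuous_on_divide) (auto simp: invertible_det_nz)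
  then show ?thesis
    using assms(2) by (simp add: matrix_inv_component cong: continuous_on_cong)
qed


section \<open>The strong minimum principle\<close>

text \<open>Gradient and Hessian are explicit data, so a second-order operator becomes a pointwise
  function of them and linear combinations can be formed entrywise.\<close>

definition has_hessian_on ::
  "(real^'n \<Rightarrow> real) \<Rightarrow> (real^'n \<Rightarrow> real^'n) \<Rightarrow> (real^'n \<Rightarrow> real^'n^'n) \<Rightarrow> (real^'n) set \<Rightarrow> bool" where
  "has_hessian_on u Du Hu S \<longleftrightarrow> (\<forall>x\<in>S. (u has_derivative (\<lambda>v. Du x \<bullet> v)) (at x) \<and>
     (Du has_derivative (\<lambda>v. Hu x *v v)) (at x))"

lemma has_hessian_on_continuous:
  assumes "has_hessian_on u Du Hu S"
  shows "continuous_on S u"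
proof (rule has_derivative_continuous_on)
  show "(u has_derivative (\<lambda>v. Du x \<bullet> v)) (at x within S)" if "x \<in> S" for x
    using assms that by (auto simp: has_hessian_on_def intro: has_derivative_at_withinI)
qed

lemma has_hessian_on_minimum:
  assumes hess: "has_hessian_on w Dw Hw S" and S: "open S" "z \<in> S"
    and min: "\<And>x. x \<in> S \<Longrightarrow> w z \<le> w x"
  shows "Dw z = 0" "e \<bullet> (Hw z *v e) \<ge> 0"
proof -
  have der: "(w has_derivative (\<lambda>v. Dw x \<bullet> v)) (at x)" "(Dw has_derivative (\<lambda>v. Hw x *v v)) (at x)"
    if "x \<in> S" for x
    using hess that by (auto simp: has_hessian_on_def)
  have "(\<lambda>v. Dw z \<bullet> v) = (\<lambda>v. 0)"
    using differential_zero_maxmin[OF S(2,1) der(1)[OF S(2)]] min by blast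
  then show Dz: "Dw z = 0"
    by (metis inner_eq_zero_iff)
  show "e \<bullet> (Hw z *v e) \<ge> 0"
  proof (rule ccontr)
    assume neg: "\<not> ?thesis"
    then have "e \<noteq> 0" by auto
    have line: "((\<lambda>t. z + t *\<^sub>R e) has_derivative (\<lambda>s. s *\<^sub>R e)) (at t)" for t
      by (auto intro!: derivative_eq_intros)
    \<comment> \<open>The slope of \<open>w\<close> along the line through \<open>z\<close> in
      direction \<open>e\<close>. It vanishes at 0; a negative second derivative would make it
      negative just to the right, and the mean value theorem would then push \<open>w\<close> below
      its minimum.\<close>
    define f' where "f' t = Dw (z + t *\<^sub>R e) \<bullet> e" for t
    have "((\<lambda>t. Dw (z + t *\<^sub>R e)) has_derivative (\<lambda>s. Hw z *v (s *\<^sub>R e))) (at 0)"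
      using has_derivative_compose[OF line, of Dw "\<lambda>v. Hw z *v v" 0] der(2)[OF S(2)] by simp
    then have "(f' has_derivative (\<lambda>s. (Hw z *v (s *\<^sub>R e)) \<bullet> e)) (at 0)"
      unfolding f'_def by (rule has_derivative_inner_left)
    moreover have "(\<lambda>s. (Hw z *v (s *\<^sub>R e)) \<bullet> e) = (*) (e \<bullet> (Hw z *v e))"
      by (auto simp: matrix_vector_mult_scaleR inner_commute)
    ultimately have "(f' has_real_derivative (e \<bullet> (Hw z *v e))) (at 0)"
      by (simp add: has_field_derivative_def)
    from DERIV_neg_dec_right[OF this] neg obtain d where
      d: "d > 0" "\<And>h. 0 < h \<Longrightarrow> h < d \<Longrightarrow> f' h < f' 0"
      by auto
    obtain r where r: "r > 0" "ball z r \<subseteq> S"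
      using S openE by blast
    define t where "t = min (d / 2) (r / (2 * norm e))"
    have t: "0 < t" "t < d" "t * norm e < r"
      using d r \<open>e \<noteq> 0\<close> by (auto simp: t_def min_def field_simps)
    have inS: "z + s *\<^sub>R e \<in> S" if "0 \<le> s" "s \<le> t" for s
    proof -
      have "norm (s *\<^sub>R e) \<le> t * norm e"
        using that by (simp add: mult_right_mono)
      then have "z + s *\<^sub>R e \<in> ball z r"
        using t by (simp add: dist_norm)
      then show ?thesis using r by blast
    qed
    have "((\<lambda>s. w (z + s *\<^sub>R e)) has_real_derivative f' s) (at s)" if "0 \<le> s" "s \<le> t" for s
    proof -
      have "((\<lambda>s. w (z + s *\<^sub>R e)) has_derivative (\<lambda>h. Dw (z + s *\<^sub>R e) \<bullet> (h *\<^sub>R e))) (at s)"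
        by (rule has_derivative_compose[OF line der(1)[OF inS[OF that]]])
      moreover have "(\<lambda>h. Dw (z + s *\<^sub>R e) \<bullet> (h *\<^sub>R e)) = (*) (f' s)"
        by (auto simp: f'_def)
      ultimately show ?thesis
        by (simp add: has_field_derivative_def)
    qed
    from MVT2[OF t(1) this] obtain s where
      s: "0 < s" "s < t" "w (z + t *\<^sub>R e) - w (z + 0 *\<^sub>R e) = (t - 0) * f' s"
      by auto
    have "f' s < 0"
      using d(2)[of s] s t Dz by (simp add: f'_def)
    then have "w (z + t *\<^sub>R e) < w z"
      using s t mult_pos_neg[of t "f' s"] by simp
    then show False
      using min[OF inS[of t]] t by simp
  qed
qed

text \<open>The rank-one part of the Hessian, scaled by \<alpha>, exploits ellipticity in direction
  \<open>n\<close>; the part -2 I is the price for bending the set where the barrier is nonnegative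
  into the ball centred at \<open>z + n\<close>.\<close>

lemma has_hessian_on_barrier:
  fixes n z :: "real^'n"
  shows "has_hessian_on
     (\<lambda>x. n \<bullet> (x - z) + \<alpha> * (n \<bullet> (x - z))\<^sup>2 - (x - z) \<bullet> (x - z))
     (\<lambda>x. (1 + 2 * \<alpha> * (n \<bullet> (x - z))) *\<^sub>R n - 2 *\<^sub>R (x - z))
     (\<lambda>x. \<chi> i j. 2 * \<alpha> * n $ i * n $ j - (if i = j then 2 else 0)) S"
  unfolding has_hessian_on_def
proof (intro ballI conjI)
  fix x
  show "((\<lambda>x. n \<bullet> (x - z) + \<alpha> * (n \<bullet> (x - z))\<^sup>2 - (x - z) \<bullet> (x - z)) has_derivative
      (\<lambda>v. ((1 + 2 * \<alpha> * (n \<bullet> (x - z))) *\<^sub>R n - 2 *\<^sub>R (x - z)) \<bullet> v)) (at x)"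
    by (auto intro!: derivative_eq_intros simp: algebra_simps inner_simps inner_commute)
  have mv: "(\<chi> i j. 2 * \<alpha> * n $ i * n $ j - (if i = j then 2 else 0)) *v v
      = (2 * \<alpha> * (n \<bullet> v)) *\<^sub>R n - 2 *\<^sub>R v" for v
  proof -
    have "(\<Sum>j\<in>UNIV. (2 * \<alpha> * n $ i * n $ j - (if i = j then 2 else 0)) * v $ j)
        = 2 * \<alpha> * (\<Sum>j\<in>UNIV. n $ j * v $ j) * n $ i - 2 * v $ i" for i
      unfolding left_diff_distrib sum_subtractf
      by (simp add: sum_distrib_left sum_distrib_right mult_ac if_distrib[of "\<lambda>c. _ * c"] cong: if_cong)
    then show ?thesis
      by (simp add: vec_eq_iff matrix_vector_mult_def inner_vec_def)
  qed
  show "((\<lambda>x. (1 + 2 * \<alpha> * (n \<bullet> (x - z))) *\<^sub>R n - 2 *\<^sub>R (x - z)) has_derivative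
      (\<lambda>v. (\<chi> i j. 2 * \<alpha> * n $ i * n $ j - (if i = j then 2 else 0)) *v v)) (at x)"
    unfolding mv by (auto intro!: derivative_eq_intros simp: algebra_simps)
qed

lemma has_hessian_on_lincomb:
  assumes "has_hessian_on u Du Hu S" "has_hessian_on v Dv Hv S"
  shows "has_hessian_on (\<lambda>x. u x - m - \<epsilon> * v x) (\<lambda>x. Du x - \<epsilon> *\<^sub>R Dv x)
    (\<lambda>x. \<chi> i j. Hu x $ i $ j - \<epsilon> * Hv x $ i $ j) S"
  unfolding has_hessian_on_def
proof (intro ballI conjI)
  fix x assume "x \<in> S"
  with assms have
    der: "(u has_derivative (\<lambda>v. Du x \<bullet> v)) (at x)" "(Du has_derivative (\<lambda>v. Hu x *v v)) (at x)"
      "(v has_derivative (\<lambda>v. Dv x \<bullet> v)) (at x)" "(Dv has_derivative (\<lambda>v. Hv x *v v)) (at x)"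
    by (auto simp: has_hessian_on_def)
  show "((\<lambda>x. u x - m - \<epsilon> * v x) has_derivative (\<lambda>v. (Du x - \<epsilon> *\<^sub>R Dv x) \<bullet> v)) (at x)"
    by (auto intro!: derivative_eq_intros der simp: inner_simps)
  have mv: "(\<chi> i j. Hu x $ i $ j - \<epsilon> * Hv x $ i $ j) *v y = Hu x *v y - \<epsilon> *\<^sub>R (Hv x *v y)" for y
    by (simp add: vec_eq_iff matrix_vector_mult_def sum_subtractf sum_distrib_left algebra_simps)
  show "((\<lambda>x. Du x - \<epsilon> *\<^sub>R Dv x) has_derivative
      (\<lambda>y. (\<chi> i j. Hu x $ i $ j - \<epsilon> * Hv x $ i $ j) *v y)) (at x)"
    unfolding mv by (auto intro!: derivative_eq_intros der)
qed

text \<open>The sign of \<open>b\<close> is that of the Christoffel term in \<open>hess\<close>.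
  There is no zeroth-order term, so constants can be subtracted from the function freely.\<close>

definition elliptic_op ::
  "real^'n^'n \<Rightarrow> real^'n \<Rightarrow> real^'n \<Rightarrow> real^'n^'n \<Rightarrow> real" where
  "elliptic_op A b d H = (\<Sum>i\<in>UNIV. \<Sum>j\<in>UNIV. A$i$j * H$j$i) - b \<bullet> d"

text \<open>
  Hopf's barrier is usually an exponential.  The quadratic polynomial \<open>v\<close> below suffices: near the
  touching point \<open>z\<close> the set where \<open>v \<ge> 0\<close> lies, except for \<open>z\<close> itself, in the ball about \<open>y\<close>.
\<close>

lemma no_interior_touching_ball:
  fixes u :: "real^'n \<Rightarrow> real"
  assumes S: "open S" and u: "has_hessian_on u Du Hu S"
    and A: "\<And>x. x \<in> S \<Longrightarrow> pos_def (A x)" "\<And>i j. continuous_on S (\<lambda>x. A x $ i $ j)"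
    and b: "continuous_on S b"
    and super: "\<And>x. x \<in> S \<Longrightarrow> elliptic_op (A x) (b x) (Du x) (Hu x) \<le> 0"
    and lower: "\<And>x. x \<in> S \<Longrightarrow> m \<le> u x"
    and z: "z \<in> S" "u z = m" "y \<noteq> z"
    and ball: "\<And>x. x \<in> S \<Longrightarrow> dist y x < dist y z \<Longrightarrow> m < u x"
  shows False
proof -
  define n where "n = y - z"
  have "n \<noteq> 0" using z by (simp add: n_def)
  define Q where "Q = n \<bullet> (A z *v n)"
  have "Q > 0"
    using A(1)[OF z(1)] \<open>n \<noteq> 0\<close> by (simp add: Q_def pos_def_def)
  define T where "T = 2 * (\<Sum>i\<in>UNIV. A z $ i $ i) + b z \<bullet> n"
  \<comment> \<open>At \<open>z\<close> the operator applied to the barrier equals 2 \<alpha> Q - T,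
    where T collects the -2 I part and the first-order term; this \<alpha> makes it |T| + 1 -
    T.\<close>
  define \<alpha> where "\<alpha> = (\<bar>T\<bar> + 1) / (2 * Q)"
  have "\<alpha> > 0" "2 * \<alpha> * Q - T > 0"
    using \<open>Q > 0\<close> by (auto simp: \<alpha>_def)
  define v where "v x = n \<bullet> (x - z) + \<alpha> * (n \<bullet> (x - z))\<^sup>2 - (x - z) \<bullet> (x - z)" for x
  define Dv where "Dv x = (1 + 2 * \<alpha> * (n \<bullet> (x - z))) *\<^sub>R n - 2 *\<^sub>R (x - z)" for x
  define Hv where "Hv = (\<lambda>x::real^'n. (\<chi> i j. 2 * \<alpha> * n $ i * n $ j - (if i = j then 2 else 0)) :: real^'n^'n)"
  have v: "has_hessian_on v Dv Hv S"
    using has_hessian_on_barrier[of n z \<alpha> S] unfolding v_def[abs_def] Dv_def[abs_def] Hv_def by simp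
  define L where "L x = elliptic_op (A x) (b x) (Dv x) (Hv x)" for x
  have "L z = 2 * \<alpha> * Q - T"
    by (simp add: L_def elliptic_op_def Dv_def Hv_def Q_def T_def inner_vec_def matrix_vector_mult_def
        right_diff_distrib sum_subtractf sum_distrib_left mult_ac if_distrib[of "\<lambda>c. _ * c"] cong: if_cong)
  then have "L z > 0"
    using \<open>2 * \<alpha> * Q - T > 0\<close> by simp
  have "continuous_on S L"
    unfolding L_def elliptic_op_def Dv_def Hv_def vec_lambda_beta
    by (intro A(2) b continuous_intros)
  then have "open (S \<inter> L -` {0<..})"
    using S continuous_open_preimage open_greaterThan by blast
  moreover have "z \<in> S \<inter> L -` {0<..}"
    using z \<open>L z > 0\<close> by simp
  ultimately obtain r0 where r0: "r0 > 0" "cball z r0 \<subseteq> S \<inter> L -` {0<..}"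
    using open_contains_cball by blast
  \<comment> \<open>The second bound gives \<alpha> |n \<bullet> (x - z)| \<le> 1/2 on the closed
    ball, which keeps the factor 1 + \<alpha> s below between 0 and 2.\<close>
  define r where "r = min r0 (1 / (2 * \<alpha> * norm n))"
  have r: "r > 0" "cball z r \<subseteq> S" "\<And>x. x \<in> cball z r \<Longrightarrow> L x > 0"
    using r0 \<open>\<alpha> > 0\<close> \<open>n \<noteq> 0\<close> by (auto simp: r_def)
  have r_small: "\<alpha> * (norm n * r) < 1"
  proof -
    have "\<alpha> * (norm n * r) \<le> \<alpha> * (norm n * (1 / (2 * \<alpha> * norm n)))"
      using \<open>\<alpha> > 0\<close> by (intro mult_left_mono) (auto simp: r_def)
    also have "\<dots> < 1"
      using \<open>\<alpha> > 0\<close> \<open>n \<noteq> 0\<close> by simp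
    finally show ?thesis .
  qed
  \<comment> \<open>Where \<open>v\<close> is nonnegative on the sphere, r^2 \<le> s (1 + \<alpha>
    s) < 2 s. This says |n - \<xi>| < |n|, so \<open>x\<close> is strictly nearer to
    \<open>y\<close> than \<open>z\<close> is.\<close>
  have inside: "dist y x < dist y z" if x: "x \<in> sphere z r" and vx: "v x \<ge> 0" for x
  proof -
    define \<xi> where "\<xi> = x - z"
    have nx: "norm \<xi> = r"
      using x by (simp add: \<xi>_def dist_norm norm_minus_commute)
    define s where "s = n \<bullet> \<xi>"
    have "\<bar>s\<bar> \<le> norm n * r"
      using Cauchy_Schwarz_ineq2[of n \<xi>] nx by (simp add: s_def)
    then have "\<alpha> * \<bar>s\<bar> \<le> \<alpha> * (norm n * r)"
      using \<open>\<alpha> > 0\<close> by (intro mult_left_mono) auto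
    with r_small have as: "\<alpha> * \<bar>s\<bar> < 1" by linarith
    have \<xi>2: "\<xi> \<bullet> \<xi> = r\<^sup>2"
      using nx by (simp add: dot_square_norm)
    then have le: "r\<^sup>2 \<le> s * (1 + \<alpha> * s)"
      using vx by (simp add: v_def \<xi>_def s_def algebra_simps power2_eq_square)
    have "0 < r\<^sup>2" using r(1) by simp
    have "\<bar>\<alpha> * s\<bar> < 1"
      using as \<open>\<alpha> > 0\<close> by (simp add: abs_mult)
    then have f: "0 < 1 + \<alpha> * s" "1 + \<alpha> * s < 2"
      by linarith+
    have "s > 0"
      using le f \<open>0 < r\<^sup>2\<close> by (smt (verit) mult_nonpos_nonneg)
    then have "s * (1 + \<alpha> * s) < s * 2"
      using f by (intro mult_strict_left_mono) auto
    with le have "r\<^sup>2 < 2 * s" by linarith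
    then have "(norm (n - \<xi>))\<^sup>2 < (norm n)\<^sup>2"
      using \<xi>2 by (simp add: power2_norm_eq_inner inner_simps s_def inner_commute)
    then have "norm (n - \<xi>) < norm n"
      by (simp add: power_less_imp_less_base)
    then show ?thesis
      by (simp add: n_def \<xi>_def dist_norm)
  qed
  have contv: "continuous_on X v" for X
    unfolding v_def by (intro continuous_intros)
  have contu: "continuous_on S u"
    by (rule has_hessian_on_continuous[OF u])
  define K where "K = sphere z r \<inter> v -` {0..}"
  have "closed (v -` {0..})"
    using contv[of UNIV] by (auto intro!: continuous_closed_vimage simp: continuous_on_eq_continuous_at)
  then have "compact K"
    unfolding K_def by (intro compact_Int_closed) auto
  have KS: "K \<subseteq> S"
    using r by (auto simp: K_def)
  \<comment> \<open>On the compact set \<open>K\<close> the hypothesis on the ball gives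
    \<open>u\<close> a positive gap above \<open>m\<close>, which a small multiple of
    \<open>v\<close> cannot close. The rest of the sphere needs no smallness, since \<open>v\<close>
    is negative there.\<close>
  have "\<exists>\<epsilon>>0. \<forall>x\<in>K. \<epsilon> * v x < u x - m"
  proof (cases "K = {}")
    case True
    then show ?thesis by (auto intro: exI[of _ 1])
  next
    case False
    have "continuous_on K u"
      using contu KS continuous_on_subset by blast
    then obtain p where p: "p \<in> K" "\<And>x. x \<in> K \<Longrightarrow> u p \<le> u x"
      using continuous_attains_inf[OF \<open>compact K\<close> False] by blast
    obtain q where q: "q \<in> K" "\<And>x. x \<in> K \<Longrightarrow> v x \<le> v q"
      using continuous_attains_sup[OF \<open>compact K\<close> False contv] by blast
    have "u p > m"
      using p KS inside ball by (auto simp: K_def)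
    define \<epsilon> where "\<epsilon> = (u p - m) / (v q + 1)"
    have vq: "v q \<ge> 0" using q by (simp add: K_def)
    then have "\<epsilon> > 0"
      using \<open>u p > m\<close> by (simp add: \<epsilon>_def)
    moreover have "\<epsilon> * v x < u x - m" if "x \<in> K" for x
    proof -
      have "\<epsilon> * v x \<le> \<epsilon> * v q"
        using q(2)[OF that] \<open>\<epsilon> > 0\<close> by simp
      also have "\<dots> < \<epsilon> * (v q + 1)"
        using \<open>\<epsilon> > 0\<close> by simp
      also have "\<dots> = u p - m"
        using vq by (simp add: \<epsilon>_def)
      also have "\<dots> \<le> u x - m"
        using p(2)[OF that] by simp
      finally show ?thesis .
    qed
    ultimately show ?thesis by blast
  qed
  then obtain \<epsilon> where eps: "\<epsilon> > 0" "\<And>x. x \<in> K \<Longrightarrow> \<epsilon> * v x < u x - m"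
    by blast
  define w where "w x = u x - m - \<epsilon> * v x" for x
  have w_sphere: "w x > 0" if "x \<in> sphere z r" for x
  proof (cases "v x \<ge> 0")
    case True
    then show ?thesis using eps(2)[of x] that by (simp add: K_def w_def)
  next
    case False
    then have "\<epsilon> * v x < 0" using eps(1) by (simp add: mult_pos_neg)
    moreover have "x \<in> S" using that r by auto
    ultimately show ?thesis using lower[of x] by (simp add: w_def)
  qed
  have "continuous_on (cball z r) w"
    unfolding w_def using contu r(2) contv
    by (auto intro!: continuous_intros intro: continuous_on_subset)
  then obtain x0 where x0: "x0 \<in> cball z r" "\<And>x. x \<in> cball z r \<Longrightarrow> w x0 \<le> w x"
    using continuous_attains_inf[of "cball z r" w] r(1) by auto
  \<comment> \<open>Since \<open>w\<close> is positive on the sphere, its minimum over the closed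
    ball lies inside. There the gradient vanishes and the second-order part is nonnegative, whereas
    superharmonicity of \<open>u\<close> and L > 0 make the operator on \<open>w\<close>
    negative.\<close>
  have "w z = 0" by (simp add: w_def v_def z)
  then have "w x0 \<le> 0"
    using x0(2)[of z] r(1) by simp
  then have x0b: "x0 \<in> ball z r"
    using x0(1) w_sphere[of x0] by force
  define Hw where "Hw x = (\<chi> i j. Hu x $ i $ j - \<epsilon> * Hv x $ i $ j)" for x
  have "has_hessian_on w (\<lambda>x. Du x - \<epsilon> *\<^sub>R Dv x) Hw S"
    using has_hessian_on_lincomb[OF u v, of m \<epsilon>] unfolding w_def[abs_def] Hw_def[abs_def] .
  then have w: "has_hessian_on w (\<lambda>x. Du x - \<epsilon> *\<^sub>R Dv x) Hw (ball z r)"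
    using r(2) ball_subset_cball[of z r] unfolding has_hessian_on_def by blast
  have x0min: "w x0 \<le> w x" if "x \<in> ball z r" for x
    using that x0(2) by auto
  note min = has_hessian_on_minimum[OF w open_ball x0b x0min]
  have x0S: "x0 \<in> S" using x0(1) r(2) by auto
  have "0 \<le> (\<Sum>i\<in>UNIV. \<Sum>j\<in>UNIV. A x0 $ i $ j * Hw x0 $ j $ i)"
    by (rule pos_def_trace_nonneg[OF A(1)[OF x0S] min(2)])
  also have "\<dots> = elliptic_op (A x0) (b x0) (Du x0 - \<epsilon> *\<^sub>R Dv x0) (Hw x0)"
    using min(1) by (simp add: elliptic_op_def)
  also have "\<dots> = elliptic_op (A x0) (b x0) (Du x0) (Hu x0) - \<epsilon> * L x0"
    by (simp add: elliptic_op_def L_def Hw_def inner_simps right_diff_distrib sum_subtractf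
        sum_distrib_left algebra_simps)
  also have "\<dots> < 0"
    using super[OF x0S] r(3)[OF x0(1)] eps(1) by (smt (verit) mult_pos_pos)
  finally show False by simp
qed

lemma strong_minimum_principle:
  fixes u :: "real^'n \<Rightarrow> real"
  assumes S: "open S" and u: "has_hessian_on u Du Hu S"
    and A: "\<And>x. x \<in> S \<Longrightarrow> pos_def (A x)" "\<And>i j. continuous_on S (\<lambda>x. A x $ i $ j)"
    and b: "continuous_on S b"
    and super: "\<And>x. x \<in> S \<Longrightarrow> elliptic_op (A x) (b x) (Du x) (Hu x) \<le> 0"
    and lower: "\<And>x. x \<in> S \<Longrightarrow> m \<le> u x"
    and p: "p \<in> S" "u p = m"
  obtains r where "r > 0" "ball p r \<subseteq> S" "\<And>x. x \<in> ball p r \<Longrightarrow> u x = m"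
proof -
  obtain R where R: "R > 0" "cball p R \<subseteq> S"
    using S p open_contains_cball by blast
  have contu: "continuous_on S u"
    by (rule has_hessian_on_continuous[OF u])
  \<comment> \<open>If not, let \<open>z\<close> be a point of the level set nearest to
    \<open>y\<close>: the open ball about \<open>y\<close> through \<open>z\<close> misses the level
    set and touches it at \<open>z\<close>. Halving R keeps that ball inside
    \<open>cball p R\<close>, where nearness to the level set was measured.\<close>
  have "u y = m" if y: "y \<in> ball p (R / 2)" for y
  proof (rule ccontr)
    assume "u y \<noteq> m"
    define K where "K = {x \<in> cball p R. u x = m}"
    have "continuous_on (cball p R) u"
      using contu R continuous_on_subset by blast
    then have "closed K"
      unfolding K_def by (intro continuous_closed_preimage_constant) auto
    moreover have "p \<in> K" using p R by (simp add: K_def)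
    ultimately obtain z where z: "z \<in> K" "\<And>x. x \<in> K \<Longrightarrow> dist y z \<le> dist y x"
      using distance_attains_inf[of K y] by blast
    have yz: "dist y z \<le> dist y p"
      using z(2) \<open>p \<in> K\<close> .
    have "m < u x" if "x \<in> S" "dist y x < dist y z" for x
    proof -
      have "dist p x \<le> dist p y + dist y x"
        by (rule dist_triangle)
      also have "\<dots> \<le> R"
        using that yz y by (simp add: dist_commute)
      finally have "x \<in> cball p R" by simp
      then have "u x \<noteq> m"
        using z(2)[of x] that by (auto simp: K_def)
      then show ?thesis
        using lower[OF that(1)] by simp
    qed
    moreover have "z \<in> S" "u z = m" "y \<noteq> z"
      using z R \<open>u y \<noteq> m\<close> by (auto simp: K_def)
    ultimately show False
      using no_interior_touching_ball[OF S u A b super lower] by blast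
  qed
  then show ?thesis
    using that[of "R / 2"] R by force
qed


section \<open>Stationary solutions\<close>

lemma smooth_on_continuous: "smooth_on S f \<Longrightarrow> continuous_on S f"
  unfolding smooth_on_def by (metis Ck_on.simps(1))

lemma smooth_on_differentiable: "smooth_on S f \<Longrightarrow> x \<in> S \<Longrightarrow> f differentiable (at x)"
  unfolding smooth_on_def by (metis Ck_on.simps(2))

lemma smooth_on_pd: "smooth_on S f \<Longrightarrow> smooth_on S (pd i f)"
  unfolding smooth_on_def pd_def[abs_def] by (metis Ck_on.simps(2))

lemma has_derivative_pd:
  assumes "f differentiable (at x)"
  shows "(f has_derivative (\<lambda>v. (\<chi> i. pd i f x) \<bullet> v)) (at x)"
proof -
  have d: "(f has_derivative frechet_derivative f (at x)) (at x)"
    using assms frechet_derivative_works by blast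
  then have lin: "linear (frechet_derivative f (at x))"
    by (rule has_derivative_linear)
  have "frechet_derivative f (at x) v = (\<chi> i. pd i f x) \<bullet> v" for v
  proof -
    have "frechet_derivative f (at x) v = frechet_derivative f (at x) (\<Sum>i\<in>UNIV. v $ i *\<^sub>R axis i 1)"
      using basis_expansion[of v] by (simp add: scalar_mult_eq_scaleR)
    also have "\<dots> = (\<Sum>i\<in>UNIV. v $ i * pd i f x)"
      using lin by (simp add: linear_sum linear_scale pd_def)
    finally show ?thesis
      by (simp add: inner_vec_def mult.commute)
  qed
  then have "frechet_derivative f (at x) = (\<lambda>v. (\<chi> i. pd i f x) \<bullet> v)" by blast
  with d show ?thesis by simp
qed

lemma pd_eq:
  assumes "(f has_derivative f') (at x)"
  shows "pd i f x = f' (axis i 1)"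
  unfolding pd_def using frechet_derivative_at[OF assms] by simp

lemma pd_locally_constant:
  assumes "open S" "x \<in> S" "\<And>y. y \<in> S \<Longrightarrow> f y = k"
  shows "pd i f x = 0"
proof -
  have "(f has_derivative (\<lambda>_. 0)) (at x)"
    by (rule has_derivative_transform_within_open[of "\<lambda>_. k" _ _ _ S]) (use assms in auto)
  then show ?thesis
    using pd_eq by metis
qed

lemma has_hessian_on_pd:
  assumes "\<And>x. x \<in> S \<Longrightarrow> f differentiable (at x)"
    and "\<And>x j. x \<in> S \<Longrightarrow> pd j f differentiable (at x)"
  shows "has_hessian_on f (\<lambda>x. \<chi> i. pd i f x) (\<lambda>x. \<chi> j i. pd i (pd j f) x) S"
  unfolding has_hessian_on_def
proof (intro ballI conjI)
  fix x assume x: "x \<in> S"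
  show "(f has_derivative (\<lambda>v. (\<chi> i. pd i f x) \<bullet> v)) (at x)"
    using assms(1)[OF x] by (rule has_derivative_pd)
  have "((\<lambda>x. \<chi> j. pd j f x) has_derivative (\<lambda>v. \<chi> j. (\<chi> i. pd i (pd j f) x) \<bullet> v)) (at x)"
    using has_derivative_pd[OF assms(2)[OF x]]
    by (subst has_derivative_componentwise_within) (auto simp: Basis_vec_def inner_axis)
  moreover have "(\<chi> j. (\<chi> i. pd i (pd j f) x) \<bullet> v) = (\<chi> j i. pd i (pd j f) x) *v v" for v
    by (simp add: vec_eq_iff inner_vec_def matrix_vector_mult_def)
  ultimately show "((\<lambda>x. \<chi> i. pd i f x) has_derivative (\<lambda>v. (\<chi> j i. pd i (pd j f) x) *v v)) (at x)"
    by simp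
qed

lemma pd_powr_half:
  assumes "f differentiable (at x)" "f x > 0"
  shows "pd i (\<lambda>y. f y powr (1/2)) x = (1/2) * f x powr (-1/2) * pd i f x"
    "(\<lambda>y. f y powr (1/2)) differentiable (at x)"
proof -
  have "((\<lambda>y. f y powr (1/2)) has_derivative
      (\<lambda>v. (1/2) * f x powr (-1/2) * ((\<chi> i. pd i f x) \<bullet> v))) (at x)"
    using assms(2) powr_diff[of "f x" "1/2" 1]
    by (auto intro!: derivative_eq_intros has_derivative_pd[OF assms(1)])
  from pd_eq[OF this] this show "pd i (\<lambda>y. f y powr (1/2)) x = (1/2) * f x powr (-1/2) * pd i f x"
    "(\<lambda>y. f y powr (1/2)) differentiable (at x)"
    by (auto simp: inner_axis differentiable_def)
qed

lemma has_hessian_on_powr_half: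
  assumes "open S" "smooth_on S f" "\<And>x. x \<in> S \<Longrightarrow> f x > 0"
  defines "u \<equiv> \<lambda>y. f y powr (1/2)"
  shows "has_hessian_on u (\<lambda>x. \<chi> i. pd i u x) (\<lambda>x. \<chi> j i. pd i (pd j u) x) S"
proof (rule has_hessian_on_pd)
  note diff = smooth_on_differentiable[OF assms(2)]
  show "u differentiable (at x)" if "x \<in> S" for x
    unfolding u_def using pd_powr_half(2)[OF diff[OF that] assms(3)[OF that]] .
  show "pd j u differentiable (at x)" if x: "x \<in> S" for x j
  proof -
    have "pd j f differentiable (at x)"
      using smooth_on_differentiable[OF smooth_on_pd[OF assms(2)] x] .
    moreover have "(\<lambda>y. f y powr (-1/2)) differentiable (at x)"
      using has_derivative_pd[OF diff[OF x]] assms(3)[OF x]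
      by (auto simp: differentiable_def intro!: exI derivative_eq_intros)
    ultimately have "(\<lambda>y. (1/2) * f y powr (-1/2) * pd j f y) differentiable (at x)"
      by (intro differentiable_mult) auto
    then obtain D where "((\<lambda>y. (1/2) * f y powr (-1/2) * pd j f y) has_derivative D) (at x)"
      by (auto simp: differentiable_def)
    \<comment> \<open>The chain-rule formula for \<open>pd j u\<close> is known only on
      \<open>S\<close>, where \<open>f\<close> is positive; openness of \<open>S\<close> lets its
      derivative be transferred.\<close>
    then have "(pd j u has_derivative D) (at x)"
      by (rule has_derivative_transform_within_open[OF _ assms(1) x])
        (simp add: u_def pd_powr_half(1)[OF diff assms(3)])
    then show ?thesis
      by (auto simp: differentiable_def)
  qed
qed

section \<open>The coordinate Laplacian and the traced flow equation\<close>

abbreviation comp_matrix :: "'n::finite comps \<Rightarrow> real^'n \<Rightarrow> real^'n^'n" where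
  "comp_matrix T x \<equiv> (\<chi> i j. T i j x)"

text \<open>Brings the Laplacian into the form required by the minimum principle, with drift g^{ij}
  \<Gamma>^k_{ij}. The matrix has \<open>j\<close> as row index to match the product order in
  \<open>elliptic_op\<close>.\<close>

lemma laplacian_elliptic_op:
  "laplacian G u x = elliptic_op (comp_matrix (ginv G) x)
     (\<chi> k. \<Sum>i\<in>UNIV. \<Sum>j\<in>UNIV. ginv G i j x * christoffel G k i j x)
     (\<chi> i. pd i u x) (\<chi> j i. pd i (pd j u) x)"
proof -
  have "(\<Sum>i\<in>UNIV. \<Sum>j\<in>UNIV. ginv G i j x * (\<Sum>k\<in>UNIV. christoffel G k i j x * pd k u x))
      = (\<Sum>i\<in>UNIV. \<Sum>j\<in>UNIV. \<Sum>k\<in>UNIV. ginv G i j x * christoffel G k i j x * pd k u x)"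
    by (simp add: sum_distrib_left mult_ac)
  also have "\<dots> = (\<Sum>i\<in>UNIV. \<Sum>k\<in>UNIV. \<Sum>j\<in>UNIV. ginv G i j x * christoffel G k i j x * pd k u x)"
    by (intro sum.cong refl sum.swap)
  also have "\<dots> = (\<Sum>k\<in>UNIV. \<Sum>i\<in>UNIV. \<Sum>j\<in>UNIV. ginv G i j x * christoffel G k i j x * pd k u x)"
    by (rule sum.swap)
  finally show ?thesis
    by (simp add: laplacian_def trace_g_def hess_def elliptic_op_def inner_vec_def right_diff_distrib
        sum_subtractf sum_distrib_right)
qed

lemma comp_matrix_ginv: "comp_matrix (ginv G) x = matrix_inv (comp_matrix G x)"
  by (simp add: vec_eq_iff ginv_def)

lemma trace_g_metric:
  fixes G :: "'n::finite comps"
  assumes "pos_def (comp_matrix G x)"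
  shows "trace_g G G x = CARD('n)"
proof -
  let ?A = "comp_matrix G x"
  have "transpose ?A = ?A" using assms by (simp add: pos_def_def)
  then have sym: "G i j x = G j i x" for i j
    by (simp add: vec_eq_iff transpose_def)
  have "trace_g G G x = trace (matrix_inv ?A ** ?A)"
    by (simp add: trace_g_def ginv_def trace_def matrix_matrix_mult_def sym)
  also have "\<dots> = CARD('n)"
    using matrix_inv_mult(2)[OF pos_def_invertible[OF assms]] by (simp add: trace_def mat_def)
  finally show ?thesis .
qed

lemma trace_g_jF: "trace_g G (jF G F) x = norm2F G F x"
proof -
  have "trace_g G (jF G F) x = (\<Sum>i\<in>UNIV. \<Sum>k\<in>UNIV. \<Sum>j\<in>UNIV. \<Sum>l\<in>UNIV.
      ginv G i k x * ginv G j l x * F i j x * F k l x)"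
    by (simp add: trace_g_def jF_def sum_distrib_left mult_ac)
  also have "\<dots> = norm2F G F x"
    unfolding norm2F_def by (intro sum.cong refl sum.swap)
  finally show ?thesis .
qed

lemma norm2F_pos_def:
  assumes "pos_def (comp_matrix G x)"
  shows "norm2F G F x \<ge> 0" "norm2F G F x = 0 \<Longrightarrow> F i j x = 0"
proof -
  have *: "norm2F G F x = (\<Sum>i\<in>UNIV. \<Sum>j\<in>UNIV. \<Sum>k\<in>UNIV. \<Sum>l\<in>UNIV.
     matrix_inv (comp_matrix G x) $ i $ k * matrix_inv (comp_matrix G x) $ j $ l
     * comp_matrix F x $ i $ j * comp_matrix F x $ k $ l)"
    by (simp add: norm2F_def ginv_def)
  note q = pos_def_double_contraction[OF pos_def_matrix_inv[OF assms], of "comp_matrix F x"]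
  show "norm2F G F x \<ge> 0"
    using q(1) * by simp
  show "F i j x = 0" if "norm2F G F x = 0"
    using q(2) that * by (simp add: vec_eq_iff)
qed

text \<open>Each multiple of the metric contributes tr g = n, and tr j(F) = |F|^2; hence the factors
  1 - n/2 and 1 - n.\<close>

lemma trace_flow_g:
  assumes "pos_def (comp_matrix G x)"
  shows "(\<Sum>i\<in>UNIV. \<Sum>j\<in>UNIV. ginv G i j x * flow_g G h F i j x) =
    (1/2) * h x powr (1/2) * (1 - real CARD('n) / 2) * scal G x
    - (1/2) * (1 - real CARD('n)) * laplacian G (\<lambda>y. h y powr (1/2)) x
    - (1/8) * h x powr (-1) * (1 - real CARD('n) / 2) * norm2F G F (x :: real^'n)"
proof -
  \<comment> \<open>Linearity of the trace, stated for arbitrary arrays so that no geometric term is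
    unfolded during the rearrangement.\<close>
  have expand: "(\<Sum>i\<in>UNIV. \<Sum>j\<in>UNIV. g i j * (a * (R i j - p * M i j) - b * (H i j - q * M i j) - c * (J i j - r * M i j)))
    = a * (\<Sum>i\<in>UNIV. \<Sum>j\<in>UNIV. g i j * R i j) - b * (\<Sum>i\<in>UNIV. \<Sum>j\<in>UNIV. g i j * H i j)
      - c * (\<Sum>i\<in>UNIV. \<Sum>j\<in>UNIV. g i j * J i j)
      - (a * p - b * q - c * r) * (\<Sum>i\<in>UNIV. \<Sum>j\<in>UNIV. g i j * M i j)"
    for g R M H J :: "'n \<Rightarrow> 'n \<Rightarrow> real" and a p b q c r
    by (simp add: sum_distrib_left sum_subtractf sum.distrib algebra_simps)
  have ring: "(1/2) * a * s - (1/2) * l - (1/8) * b * q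
      - ((1/2) * a * ((1/2) * s) - (1/2) * l - (1/8) * b * ((1/2) * q)) * N
    = (1/2) * a * (1 - N / 2) * s - (1/2) * (1 - N) * l - (1/8) * b * (1 - N / 2) * q"
    for a s l b q N :: real
    by (simp add: field_simps)
  show ?thesis
    unfolding flow_g_def expand trace_g_metric[where G = G and x = x, OF assms, unfolded trace_g_def]
      trace_g_jF[of G F x, unfolded trace_g_def] ring[symmetric]
    by (simp only: scal_def laplacian_def trace_g_def)
qed

text \<open>For n = 6 the traced equation has coefficients -1, 5/2 and 1/4. Eliminating the scalar
  curvature leaves (5/2) \<Delta>u = -(1/2 + 1/4) |F|^2 / h.\<close>

lemma stationary_laplacian:
  fixes G :: "6 comps"
  assumes "pos_def (comp_matrix G x)" "h x > 0"
    and "\<And>i j. flow_g G h F i j x = 0" "flow_h G h F x = 0"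
  shows "laplacian G (\<lambda>y. h y powr (1/2)) x = - (3/10) * h x powr (-1) * norm2F G F x"
proof -
  let ?L = "laplacian G (\<lambda>y. h y powr (1/2)) x"
  have "h x powr (-1/2) * scal G x = - (1/2) * h x powr (-2) * norm2F G F x"
    using assms(4) unfolding flow_h_def by linarith
  \<comment> \<open>Multiplication by h turns the exponents -1/2 and -2 of the second equation into
    the 1/2 and -1 of the traced first one.\<close>
  then have "h x powr 1 * (h x powr (-1/2) * scal G x) = h x powr 1 * (- (1/2) * h x powr (-2) * norm2F G F x)"
    by simp
  moreover have "h x powr 1 * h x powr (-1/2) = h x powr (1/2)" "h x powr 1 * h x powr (-2) = h x powr (-1)"
    unfolding powr_add[symmetric] by simp_all
  ultimately have scal: "h x powr (1/2) * scal G x = - (1/2) * (h x powr (-1) * norm2F G F x)"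
    by (metis (no_types, opaque_lifting) mult.assoc mult.left_commute)
  have "0 = - (h x powr (1/2) * scal G x) + (5/2) * ?L + (1/4) * (h x powr (-1) * norm2F G F x)"
    using trace_flow_g[where G = G and x = x, OF assms(1), of h F] assms(3) by simp
  with scal show ?thesis by simp
qed

section \<open>Components of tensors and regularity of the metric coefficients\<close>

lemma bilinear_components:
  fixes B :: "real^'n \<Rightarrow> real^'n \<Rightarrow> real"
  assumes "bilinear B"
  shows "B v w = (\<Sum>i\<in>UNIV. \<Sum>j\<in>UNIV. v $ i * w $ j * B (axis i 1) (axis j 1))"
proof -
  have "B v w = B (\<Sum>i\<in>UNIV. v $ i *\<^sub>R axis i 1) (\<Sum>j\<in>UNIV. w $ j *\<^sub>R axis j 1)"
    using basis_expansion[of v] basis_expansion[of w] by (simp add: scalar_mult_eq_scaleR)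
  also have "\<dots> = (\<Sum>(i, j)\<in>UNIV \<times> UNIV. B (v $ i *\<^sub>R axis i 1) (w $ j *\<^sub>R axis j 1))"
    by (rule bilinear_sum[OF assms])
  finally show ?thesis
    using assms by (simp add: sum.cartesian_product bilinear_lmul bilinear_rmul mult_ac)
qed

lemma riemannian_metric_pos_def:
  fixes M :: "('a, real^'n) manifold"
  assumes "riemannian_metric M g" "c \<in> atlas M" "x \<in> crange c"
  shows "pos_def (comp_matrix (coord_comps g c) x)"
proof -
  have bil: "bilinear (g c x)" and sym: "\<And>v w. g c x v w = g c x w v"
    and pos: "\<And>v. v \<noteq> 0 \<Longrightarrow> g c x v v > 0"
    using assms by (auto simp: riemannian_metric_def two_tensor_def)
  have "v \<bullet> (comp_matrix (coord_comps g c) x *v v) = g c x v v" for v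
    unfolding bilinear_components[OF bil, of v v]
    by (simp add: coord_comps_def inner_vec_def matrix_vector_mult_def sum_distrib_left mult_ac)
  then show ?thesis
    using sym pos by (simp add: pos_def_def transpose_def vec_eq_iff coord_comps_def)
qed

lemma riemannian_metric_smooth_comps:
  assumes "riemannian_metric M g" "c \<in> atlas M"
  shows "smooth_on (crange c) (coord_comps g c i j)"
  using assms by (simp add: riemannian_metric_def two_tensor_def coord_comps_def[abs_def])

lemma continuous_on_ginv:
  assumes "\<And>i j. smooth_on S (G i j)" "\<And>x. x \<in> S \<Longrightarrow> pos_def (comp_matrix G x)"
  shows "continuous_on S (ginv G i j)"
  unfolding ginv_def[abs_def]
proof (rule continuous_on_matrix_inv_component)
  show "continuous_on S (\<lambda>x. comp_matrix G x $ i $ j)" for i j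
    using smooth_on_continuous[OF assms(1)] by simp
qed (use assms(2) pos_def_invertible in blast)

lemma continuous_on_christoffel:
  assumes "\<And>i j. smooth_on S (G i j)" "\<And>x. x \<in> S \<Longrightarrow> pos_def (comp_matrix G x)"
  shows "continuous_on S (christoffel G k i j)"
  unfolding christoffel_def[abs_def]
  by (intro continuous_intros continuous_on_ginv smooth_on_continuous smooth_on_pd assms)

text \<open>The differential inequality holds for the square root of h, not for h itself;
  monotonicity of the root carries the minimum there and its injectivity on positive numbers carries
  constancy back.\<close>

lemma stationary_local_minimum:
  fixes G :: "6 comps"
  assumes S: "open S" and h: "smooth_on S h" "\<And>x. x \<in> S \<Longrightarrow> m \<le> h x" "m > 0"
    and G: "\<And>i j. smooth_on S (G i j)" "\<And>x. x \<in> S \<Longrightarrow> pos_def (comp_matrix G x)"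
    and flow: "\<And>x i j. x \<in> S \<Longrightarrow> flow_g G h F i j x = 0" "\<And>x. x \<in> S \<Longrightarrow> flow_h G h F x = 0"
    and p: "p \<in> S" "h p = m"
  obtains r where "r > 0" "ball p r \<subseteq> S" "\<And>x. x \<in> ball p r \<Longrightarrow> h x = m"
proof -
  have hpos: "h x > 0" if "x \<in> S" for x
    using h(2)[OF that] h(3) by simp
  define u where "u = (\<lambda>y. h y powr (1/2))"
  define b where "b = (\<lambda>x. \<chi> k. \<Sum>i\<in>UNIV. \<Sum>j\<in>UNIV. ginv G i j x * christoffel G k i j x)"
  have hess: "has_hessian_on u (\<lambda>x. \<chi> i. pd i u x) (\<lambda>x. \<chi> j i. pd i (pd j u) x) S"
    unfolding u_def by (rule has_hessian_on_powr_half[OF S h(1) hpos])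
  have pos: "pos_def (comp_matrix (ginv G) x)" if "x \<in> S" for x
    unfolding comp_matrix_ginv by (rule pos_def_matrix_inv[OF G(2)[OF that]])
  have cont: "continuous_on S (\<lambda>x. comp_matrix (ginv G) x $ i $ j)" for i j
    using continuous_on_ginv[OF G, where i = i and j = j] by simp
  have contb: "continuous_on S b"
    unfolding b_def by (intro continuous_intros continuous_on_ginv continuous_on_christoffel G)
  have super: "elliptic_op (comp_matrix (ginv G) x) (b x) (\<chi> i. pd i u x) (\<chi> j i. pd i (pd j u) x) \<le> 0"
    if x: "x \<in> S" for x
  proof -
    have "laplacian G u x = - (3/10) * h x powr (-1) * norm2F G F x"
      unfolding u_def using flow x by (intro stationary_laplacian G(2) hpos) auto
    also have "\<dots> \<le> 0"
      using norm2F_pos_def(1)[where G = G and x = x, OF G(2)[OF x], of F] by simp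
    finally show ?thesis
      by (simp add: laplacian_elliptic_op b_def)
  qed
  have lower: "m powr (1/2) \<le> u x" if "x \<in> S" for x
    unfolding u_def using h(2)[OF that] h(3) by (intro powr_mono2) auto
  have up: "u p = m powr (1/2)" by (simp add: u_def p)
  obtain r where r: "r > 0" "ball p r \<subseteq> S" "\<And>x. x \<in> ball p r \<Longrightarrow> u x = m powr (1/2)"
    using strong_minimum_principle[OF S hess pos cont contb super lower p(1) up] by blast
  have "h x = m" if "x \<in> ball p r" for x
  proof -
    have "h x > 0" using that r(2) hpos by blast
    then show ?thesis
      using r(3)[OF that] h(3) by (simp add: u_def powr_half_sqrt)
  qed
  with r that show ?thesis by blast
qed

text \<open>Constancy on a neighbourhood kills the Laplacian, so the Laplacian identity leaves |F|^2
  = 0, and \<open>flow_h\<close> then leaves only the scalar curvature. Positivity of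
  \<open>k\<close> permits cancelling the powers of h.\<close>

lemma stationary_constant:
  fixes G :: "6 comps"
  assumes S: "open S" "x \<in> S" and h: "\<And>y. y \<in> S \<Longrightarrow> h y = k" "k > 0"
    and G: "pos_def (comp_matrix G x)"
    and flow: "\<And>i j. flow_g G h F i j x = 0" "flow_h G h F x = 0"
  shows "F i j x = 0" "scal G x = 0"
proof -
  define u where "u = (\<lambda>y. h y powr (1/2))"
  have "pd j u y = 0" if "y \<in> S" for y j
    by (rule pd_locally_constant[OF S(1) that, where k = "k powr (1/2)"]) (simp add: u_def h)
  then have "pd j u x = 0" "pd i (pd j u) x = 0" for i j
    using pd_locally_constant[OF S, where f = "pd j u"] S(2) by blast+
  then have "laplacian G u x = 0"
    by (simp add: laplacian_def trace_g_def hess_def)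
  moreover have "laplacian G u x = - (3/10) * h x powr (-1) * norm2F G F x"
    unfolding u_def using h S(2) flow by (intro stationary_laplacian G) auto
  ultimately have *: "norm2F G F x = 0"
    using h S(2) by simp
  then show "F i j x = 0"
    by (rule norm2F_pos_def(2)[where G = G and x = x, OF G])
  show "scal G x = 0"
    using flow(2) h S(2) * by (simp add: flow_h_def)
qed

section \<open>Charts and the passage from coordinates to the manifold\<close>

lemma is_chart_inv_into:
  assumes "is_chart X c"
  shows "x \<in> crange c \<Longrightarrow> inv_into (fst c) (snd c) x \<in> fst c"
    and "p \<in> fst c \<Longrightarrow> inv_into (fst c) (snd c) (snd c p) = p"
proof -
  show "x \<in> crange c \<Longrightarrow> inv_into (fst c) (snd c) x \<in> fst c"
    by (rule inv_into_into)
  have "fst c \<subseteq> topspace X"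
    using assms by (simp add: is_chart_def openin_subset)
  moreover have "inj_on (snd c) (topspace (subtopology X (fst c)))"
    using assms homeomorphic_imp_injective_map unfolding is_chart_def by blast
  ultimately have "inj_on (snd c) (fst c)"
    by (simp add: Int_absorb1)
  then show "p \<in> fst c \<Longrightarrow> inv_into (fst c) (snd c) (snd c p) = p"
    by (rule inv_into_f_f)
qed

lemma is_chart_continuous_map:
  assumes "is_chart X c"
  shows "continuous_map (subtopology X (fst c)) (top_of_set (crange c)) (snd c)"
  using assms homeomorphic_imp_continuous_map unfolding is_chart_def by blast

lemma is_chart_openin_vimage:
  assumes "is_chart X c" "open V"
  shows "openin X {q \<in> fst c. snd c q \<in> V}"
proof -
  have sub: "fst c \<subseteq> topspace X" "openin X (fst c)"
    using assms by (simp_all add: is_chart_def openin_subset)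
  have "openin (top_of_set (crange c)) (crange c \<inter> V)"
    using assms(2) by (simp add: openin_open_Int)
  from openin_continuous_map_preimage[OF is_chart_continuous_map[OF assms(1)] this]
  have "openin (subtopology X (fst c)) {q \<in> topspace (subtopology X (fst c)). snd c q \<in> crange c \<inter> V}" .
  also have "{q \<in> topspace (subtopology X (fst c)). snd c q \<in> crange c \<inter> V} = {q \<in> fst c. snd c q \<in> V}"
    using sub by auto
  finally show ?thesis
    using sub(2) openin_trans_full by blast
qed

lemma smooth_manifold_covered:
  assumes "smooth_manifold M" "p \<in> points M"
  obtains c where "c \<in> atlas M" "p \<in> fst c"
  using assms unfolding smooth_manifold_def by (metis UN_E)

text \<open>Continuity is glued from the charts. It yields both the existence of a minimum on the
  compact manifold and the closedness of the minimum set.\<close>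

lemma smooth_fun_continuous_map:
  assumes "smooth_manifold M" "smooth_fun M f"
  shows "continuous_map (mtop M) euclideanreal f"
proof (rule pasting_lemma[where I = "atlas M" and T = fst and f = "\<lambda>_. f"])
  fix c assume c: "c \<in> atlas M"
  then have chart: "is_chart (mtop M) c"
    using assms by (simp add: smooth_manifold_def)
  then show "openin (mtop M) (fst c)"
    by (simp add: is_chart_def)
  have "continuous_on (crange c) (local_fun c f)"
    using assms(2) c smooth_on_continuous unfolding smooth_fun_def by blast
  then have "continuous_map (top_of_set (crange c)) euclideanreal (local_fun c f)"
    by simp
  from continuous_map_compose[OF is_chart_continuous_map[OF chart] this]
  have "continuous_map (subtopology (mtop M) (fst c)) euclideanreal (local_fun c f \<circ> snd c)" .
  then show "continuous_map (subtopology (mtop M) (fst c)) euclideanreal f"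
    by (rule continuous_map_eq) (auto simp: local_fun_def is_chart_inv_into(2)[OF chart])
next
  fix x assume "x \<in> points M"
  then show "\<exists>j. j \<in> atlas M \<and> x \<in> fst j \<and> f x = f x"
    using smooth_manifold_covered[OF assms(1)] by blast
qed auto

lemma stationary_fiber_length_constant:
  fixes N :: "('a, real^6) manifold"
  assumes N: "closed_connected_manifold N" and g: "riemannian_metric N g"
    and h: "smooth_fun N h" "\<And>p. p \<in> points N \<Longrightarrow> h p > 0"
    and stat: "stationary N g h F"
  shows "\<exists>k>0. \<forall>p\<in>points N. h p = k"
proof (cases "points N = {}")
  \<comment> \<open>The empty space satisfies the compactness and connectedness conditions but has
    no minimum; any positive constant serves.\<close>
  case True
  then show ?thesis by (auto intro: exI[of _ 1])
next
  case False
  have man: "smooth_manifold N" "compact_space (mtop N)" "connected_space (mtop N)"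
    using N by (auto simp: closed_connected_manifold_def)
  note conth = smooth_fun_continuous_map[OF man(1) h(1)]
  have "compact (h ` points N)"
    using image_compactin[OF _ conth] man(2) unfolding compact_space_def by simp
  then obtain p0 where p0: "p0 \<in> points N" "\<And>p. p \<in> points N \<Longrightarrow> h p0 \<le> h p"
    using compact_attains_inf[of "h ` points N"] False by auto
  \<comment> \<open>The global minimum value bounds h from below in every chart with the same
    constant, so the local principle shows that each point of \<open>Z\<close> is interior.\<close>
  define Z where "Z = {p \<in> points N. h p = h p0}"
  have "closedin (mtop N) {p \<in> points N. h p \<in> {h p0}}"
    by (rule closedin_continuous_map_preimage[OF conth]) simp
  then have "closedin (mtop N) Z"
    by (simp add: Z_def)
  moreover have "openin (mtop N) Z"
  proof (subst openin_subopen, intro ballI)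
    fix p assume p: "p \<in> Z"
    then obtain c where c: "c \<in> atlas N" "p \<in> fst c"
      using smooth_manifold_covered[OF man(1)] unfolding Z_def by blast
    then have chart: "is_chart (mtop N) c"
      using man(1) by (simp add: smooth_manifold_def)
    then have S: "open (crange c)" and sub: "fst c \<subseteq> points N"
      by (simp_all add: is_chart_def openin_subset)
    have lower: "h p0 \<le> local_fun c h x" if "x \<in> crange c" for x
      using p0(2) sub is_chart_inv_into(1)[OF chart that] by (auto simp: local_fun_def)
    have at: "local_fun c h (snd c q) = h q" if "q \<in> fst c" for q
      by (simp add: local_fun_def is_chart_inv_into(2)[OF chart that])
    have smooth: "smooth_on (crange c) (local_fun c h)"
      using h(1) c by (simp add: smooth_fun_def)
    have flow: "flow_g (coord_comps g c) (local_fun c h) (coord_comps F c) i j x = 0"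
      "flow_h (coord_comps g c) (local_fun c h) (coord_comps F c) x = 0" if "x \<in> crange c" for x i j
      using stat c(1) that unfolding stationary_def Let_def by blast+
    have "snd c p \<in> crange c" "local_fun c h (snd c p) = h p0"
      using c p at by (auto simp: Z_def)
    then obtain r where r: "r > 0" "\<And>x. x \<in> ball (snd c p) r \<Longrightarrow> local_fun c h x = h p0"
      using stationary_local_minimum[OF S smooth lower h(2)[OF p0(1)] riemannian_metric_smooth_comps[OF g c(1)]
          riemannian_metric_pos_def[OF g c(1)] flow] by blast
    show "\<exists>T. openin (mtop N) T \<and> p \<in> T \<and> T \<subseteq> Z"
    proof (intro exI conjI)
      show "openin (mtop N) {q \<in> fst c. snd c q \<in> ball (snd c p) r}"
        by (rule is_chart_openin_vimage[OF chart]) simp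
      show "p \<in> {q \<in> fst c. snd c q \<in> ball (snd c p) r}"
        using c r by simp
      show "{q \<in> fst c. snd c q \<in> ball (snd c p) r} \<subseteq> Z"
        using r(2) at sub by (force simp: Z_def)
    qed
  qed
  moreover have "p0 \<in> Z" using p0 by (simp add: Z_def)
  ultimately have "Z = points N"
    using man(3) unfolding connected_space_clopen_in by blast
  then show ?thesis
    using h(2)[OF p0(1)] by (auto simp: Z_def)
qed

theorem proposition5:
  fixes N :: "('a, real^6) manifold" and P :: "('b, real^7) manifold"
    and \<pi> :: "'b \<Rightarrow> 'a" and act :: "complex \<Rightarrow> 'b \<Rightarrow> 'b"
    and g :: "('a, real^6) field2" and h :: "'a \<Rightarrow> real"
    and \<eta> :: "('b, real^7) field1" and F :: "('a, real^6) field2"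
  assumes "closed_connected_manifold N"
    and "principal_circle_bundle P N \<pi> act"
    and "riemannian_metric N g"
    and "smooth_fun N h" and "\<forall>p\<in>points N. h p > 0"
    and "connection_form P act \<eta>"
    and "curvature_form P N \<pi> \<eta> F"
    and "stationary N g h F"
  shows "(\<forall>c\<in>atlas N. \<forall>x\<in>crange c. \<forall>v w. F c x v w = 0) \<and>
         (\<forall>c\<in>atlas N. \<forall>x\<in>crange c. scal (coord_comps g c) x = 0) \<and>
         (\<exists>k. \<forall>p\<in>points N. h p = k)"
proof -
  obtain k where k: "k > 0" "\<And>p. p \<in> points N \<Longrightarrow> h p = k"
    using stationary_fiber_length_constant[OF assms(1,3,4) _ assms(8)] assms(5) by blast
  have "F c x v w = 0 \<and> scal (coord_comps g c) x = 0" if c: "c \<in> atlas N" and x: "x \<in> crange c" for c x v w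
  proof -
    have chart: "is_chart (mtop N) c"
      using assms(1) c by (simp add: closed_connected_manifold_def smooth_manifold_def)
    then have S: "open (crange c)" and sub: "fst c \<subseteq> points N"
      by (simp_all add: is_chart_def openin_subset)
    have hk: "local_fun c h y = k" if "y \<in> crange c" for y
      using k(2) sub is_chart_inv_into(1)[OF chart that] by (auto simp: local_fun_def)
    have flow: "flow_g (coord_comps g c) (local_fun c h) (coord_comps F c) i j x = 0"
      "flow_h (coord_comps g c) (local_fun c h) (coord_comps F c) x = 0" for i j
      using assms(8) c x unfolding stationary_def Let_def by blast+
    note const = stationary_constant[OF S x hk k(1) riemannian_metric_pos_def[OF assms(3) c x] flow]
    have "bilinear (F c x)"
      using assms(7) c x unfolding curvature_form_def two_form_def two_tensor_def by blast
    \<comment> \<open>The chart computation gives vanishing only on coordinate vectors; bilinearity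
      extends it to all \<open>v\<close> and \<open>w\<close>.\<close>
    from bilinear_components[OF this, of v w] const show ?thesis
      by (simp add: coord_comps_def)
  qed
  with k show ?thesis by blast
qed

end
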